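(* For every constant $\epsilon>0$ there is a constant $C_\epsilon>0$ with the following property. For every integer $k\ge C_\epsilon$, any randomized algorithm that achieves an approximation ratio of $1/2+\epsilon$ for dynamic (fully dynamic, i.e. insertions and deletions) monotone submodular maximization under cardinality constraint $k$ must have amortized query complexity at least $n^{\tilde{\Omega}(\epsilon)}/k^3$, where $n$ is the length of the stream.
   Context: Dynamic submodular maximization under a cardinality constraint: there is a finite ground set $V$, a positive integer $k$, and query (value-oracle) access to a nonnegative monotone submodular function $f:2^V\to\mathbb{R}$ (monotone: $f(S)\le f(T)$ for $S\subseteq T$; submodular: $f(S\cup T)+f(S\cap T)\le f(S)+f(T)$). Starting from $V_0=\emptyset$, in each round $i=1,2,\dots,n$ an element $e_i$ is either inserted ($V_i=V_{i-1}\cup\{e_i\}$) or deleted ($V_i=V_{i-1}\setminus\{e_i\}$); after the update the algorithm may query $f$ and must output a set $S_i\subseteq V_i$ with $|S_i|\le k$. A $\gamma$-approximate solution in round $i$ means $f(S_i)\ge\gamma\cdot \mathrm{OPT}_i$, where $\mathrm{OPT}_i=\max_{T\subseteq V_i,|T|\le k}f(T)$. The algorithm remembers all previous query answers. A randomized algorithm achieves approximation ratio $\gamma$ if for every $n$ and every stream of length $n$, with probability at least $2/3$ it outputs a $\gamma$-approximate solution in every round $i\in[n]$. It has amortized query complexity $Q(n)$ if the total number of queries it makes on any stream of length $n$ is at most $n\cdot Q(n)$. (The lower bound holds even if the algorithm knows $V$ and $n$ in advance and may query any set of elements that have appeared so far.)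
   Formalization: The bound is proved for stream lengths n ≥ C_ε·k; without such a condition it fails, since for n ≤ k an algorithm can output V_i with no queries at all. *)

theory Defs
  imports "HOL-Probability.Probability" "HOL-Library.Landau_Symbols"
begin

definition nonneg_on :: "nat set \<Rightarrow> (nat set \<Rightarrow> real) \<Rightarrow> bool" where
  "nonneg_on V f \<longleftrightarrow> (\<forall>S. S \<subseteq> V \<longrightarrow> 0 \<le> f S)"

definition monotone_set_fun :: "nat set \<Rightarrow> (nat set \<Rightarrow> real) \<Rightarrow> bool" where
  "monotone_set_fun V f \<longleftrightarrow> (\<forall>S T. S \<subseteq> T \<and> T \<subseteq> V \<longrightarrow> f S \<le> f T)"

definition submodular :: "nat set \<Rightarrow> (nat set \<Rightarrow> real) \<Rightarrow> bool" where
  "submodular V f \<longleftrightarrow>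
     (\<forall>S T. S \<subseteq> V \<and> T \<subseteq> V \<longrightarrow> f (S \<union> T) + f (S \<inter> T) \<le> f S + f T)"

datatype update = Insert (elem: nat) | Delete (elem: nat)

fun apply_update :: "nat set \<Rightarrow> update \<Rightarrow> nat set" where
  "apply_update A (Insert e) = A \<union> {e}"
| "apply_update A (Delete e) = A - {e}"

text \<open>The set \<open>V\<^sub>i\<close>; round \<open>i \<in> {1..n}\<close> processes the list entry \<open>us ! (i - 1)\<close>.\<close>

definition active :: "update list \<Rightarrow> nat \<Rightarrow> nat set" where
  "active us i = foldl apply_update {} (take i us)"

definition appeared :: "update list \<Rightarrow> nat \<Rightarrow> nat set" where
  "appeared us i = (\<Union>j\<le>i. active us j)"

definition OPT :: "(nat set \<Rightarrow> real) \<Rightarrow> nat \<Rightarrow> nat set \<Rightarrow> real" where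
  "OPT f k A = Max (f ` {T. T \<subseteq> A \<and> card T \<le> k})"

text \<open>Ground sets are arbitrary finite sets of natural numbers; this is only a choice of
  names for the elements. Values of \<open>f\<close> outside the subsets of \<open>V\<close> are irrelevant.\<close>

definition dynamic_instance :: "nat set \<Rightarrow> (nat set \<Rightarrow> real) \<Rightarrow> update list \<Rightarrow> bool" where
  "dynamic_instance V f us \<longleftrightarrow>
     finite V \<and> nonneg_on V f \<and> monotone_set_fun V f \<and> submodular V f \<and> elem ` set us \<subseteq> V"

text \<open>The computation of one round is a well-founded decision tree: it either stops with an
  output set, or queries a set and continues depending on the value returned by the oracle.\<close>

datatype computation = Output "nat set" | Query "nat set" "real \<Rightarrow> computation"

primrec queries :: "(nat set \<Rightarrow> real) \<Rightarrow> computation \<Rightarrow> (nat set \<times> real) list" where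
  "queries f (Output S) = []"
| "queries f (Query S c) = (S, f S) # queries f (c (f S))"

primrec result :: "(nat set \<Rightarrow> real) \<Rightarrow> computation \<Rightarrow> nat set" where
  "result f (Output S) = S"
| "result f (Query S c) = result f (c (f S))"

text \<open>A deterministic algorithm knows the ground set \<open>V\<close> and the stream length \<open>n\<close> in
  advance. In each round it sees the updates up to and including the current one and the
  transcript of all queries of the earlier rounds with their answers. There is no bound on its
  computational power.\<close>

type_synonym det_algorithm =
  "nat set \<Rightarrow> nat \<Rightarrow> update list \<Rightarrow> (nat set \<times> real) list \<Rightarrow> computation"

text \<open>The transcript of all queries made in rounds \<open>1, \<dots>, i\<close>.\<close>

primrec transcript ::
  "det_algorithm \<Rightarrow> nat set \<Rightarrow> (nat set \<Rightarrow> real) \<Rightarrow> update list \<Rightarrow> nat \<Rightarrow> (nat set \<times> real) list"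
where
  "transcript D V f us 0 = []"
| "transcript D V f us (Suc i) =
     transcript D V f us i @
     queries f (D V (length us) (take (Suc i) us) (transcript D V f us i))"

definition solution ::
  "det_algorithm \<Rightarrow> nat set \<Rightarrow> (nat set \<Rightarrow> real) \<Rightarrow> update list \<Rightarrow> nat \<Rightarrow> nat set" where
  "solution D V f us i =
     result f (D V (length us) (take i us) (transcript D V f us (i - 1)))"

definition total_queries ::
  "det_algorithm \<Rightarrow> nat set \<Rightarrow> (nat set \<Rightarrow> real) \<Rightarrow> update list \<Rightarrow> nat" where
  "total_queries D V f us = length (transcript D V f us (length us))"

text \<open>The queries may involve deleted elements, but no element that has not been inserted yet.
  Since transcripts are cumulative, the condition on round \<open>i\<close> constrains the queries made in
  that round.\<close>

definition feasible_algorithm :: "nat \<Rightarrow> det_algorithm \<Rightarrow> bool" where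
  "feasible_algorithm k D \<longleftrightarrow>
     (\<forall>V f us. dynamic_instance V f us \<longrightarrow>
       (\<forall>i\<in>{1..length us}.
          (\<forall>(S, y) \<in> set (transcript D V f us i). S \<subseteq> appeared us i) \<and>
          solution D V f us i \<subseteq> active us i \<and>
          card (solution D V f us i) \<le> k))"

text \<open>A randomized algorithm is a probability distribution over deterministic ones. An
  algorithm driven by a random seed from any probability space induces such a distribution, by
  pushing the measure forward (with the largest \<open>\<sigma>\<close>-algebra that makes the map measurable).\<close>

definition randomized_algorithm :: "nat \<Rightarrow> det_algorithm measure \<Rightarrow> bool" where
  "randomized_algorithm k M \<longleftrightarrow> prob_space M \<and> (\<forall>D\<in>space M. feasible_algorithm k D)"

text \<open>Non-measurable sets have measure 0 in the library, so the lower bound on the probability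
  includes measurability of the success event. The instance is fixed before the randomness is
  drawn.\<close>

definition achieves_ratio :: "nat \<Rightarrow> det_algorithm measure \<Rightarrow> real \<Rightarrow> bool" where
  "achieves_ratio k M \<gamma> \<longleftrightarrow>
     (\<forall>V f us. dynamic_instance V f us \<longrightarrow>
       \<P>(D in M. \<forall>i\<in>{1..length us}. f (solution D V f us i) \<ge> \<gamma> * OPT f k (active us i))
         \<ge> 2 / 3)"

definition amortized_query_complexity :: "det_algorithm measure \<Rightarrow> (nat \<Rightarrow> real) \<Rightarrow> bool" where
  "amortized_query_complexity M Q \<longleftrightarrow>
     (\<forall>V f us. dynamic_instance V f us \<longrightarrow>
       (\<forall>D\<in>space M. real (total_queries D V f us) \<le> real (length us) * Q (length us)))"

text \<open>\<open>h(\<epsilon>)\<close> is \<open>g(\<epsilon>)\<close> up to constants and powers of \<open>log (1/\<epsilon>)\<close>, or larger, as \<open>\<epsilon> \<rightarrow> 0\<close>.\<close>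

definition soft_Omega :: "(real \<Rightarrow> real) \<Rightarrow> (real \<Rightarrow> real) set" where
  "soft_Omega g = {h. \<exists>d::nat. h \<in> \<Omega>[at_right 0](\<lambda>\<epsilon>. g \<epsilon> / ln (1 / \<epsilon>) ^ d)}"

end

theory Submission
  imports Defs
begin

text \<open>The elements are attached to the nodes of a \<open>d\<close>-ary tree of height about
  \<open>(4 / \<epsilon>) ln (8 / \<epsilon>)\<close>, and the stream is a depth-first traversal: a node is
  inserted when the traversal enters its subtree and deleted when it leaves it. The number of elements of a
  node is proportional to the number of leaves below it, up to a factor depending on the height only. In
  the blank instance all elements of a node are alike. In a hidden instance a random path is chosen, and
  in each inner node of the path a random block of special elements that complements the child on the path,
  whereas all other elements mostly cover what the nodes further down cover as well.
  The two functions agree on a query unless it contains both special elements of some node and elements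
  of the subtree of the child on the path, so a special block can only be found by queries made
  during the traversal of that subtree. On average these are a \<open>1 / d\<close>-fraction of the
  queries made during the traversal of the subtree of the node itself, while the block is one of very many.
  Hence an algorithm with few queries acts as on the blank instance, where \<open>k\<close> elements of
  a path cover little more than one half, although the special elements cover almost everything.

  For the last claim, let the number of levels tend to infinity. Where the special elements of the upper
  levels leave \<open>exp (- A)\<close> of the universe uncovered, ordinary elements in the same amounts leave
  another factor \<open>exp (- A)\<close>, so in total they cover the integral of \<open>exp (- 2 A)\<close> over
  \<open>A\<close>, which is at most \<open>1 / 2\<close>. The uncovered part is a convex function of
  the amounts, and the block sizes are such that its tangent at this point bounds every other choice of
  \<open>k\<close> elements.\<close>

section \<open>Averaging, simulation and residual functions\<close>

text \<open>The expected number of solved instances is at least \<open>2 / 3 * card J\<close>, so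
  some deterministic algorithm in the space of \<open>M\<close> reaches this average.\<close>

lemma sample_algorithm:
  assumes M: "randomized_algorithm k M" "achieves_ratio k M \<gamma>"
    and J: "finite J" "J \<noteq> {}"
    and inst: "\<And>j. j \<in> J \<Longrightarrow> dynamic_instance (V j) (f j) (us j)"
  obtains D where "D \<in> space M"
    "2 / 3 * real (card J) \<le> real (card {j \<in> J. \<forall>i\<in>{1..length (us j)}.
        \<gamma> * OPT (f j) k (active (us j) i) \<le> f j (solution D (V j) (f j) (us j) i)})"
proof -
  interpret prob_space M
    using M(1) by (simp add: randomized_algorithm_def)
  define ok where "ok j D \<longleftrightarrow> (\<forall>i\<in>{1..length (us j)}.
        \<gamma> * OPT (f j) k (active (us j) i) \<le> f j (solution D (V j) (f j) (us j) i))" for j D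
  define E where "E j = {D \<in> space M. ok j D}" for j
  have p: "2 / 3 \<le> prob (E j)" if "j \<in> J" for j
    using M(2) inst[OF that] unfolding achieves_ratio_def E_def ok_def by blast
  \<comment> \<open>A set that is not an event would have measure 0, contradicting
    \<open>p\<close>.\<close>
  have sets: "E j \<in> events" if "j \<in> J" for j
    using p[OF that] measure_notin_sets[of "E j" M] by fastforce
  have count: "(\<Sum>j\<in>J. indicat_real (E j) D) = real (card {j \<in> J. ok j D})" if "D \<in> space M" for D
  proof -
    have "(\<Sum>j\<in>J. indicat_real (E j) D) = (\<Sum>j\<in>J. if ok j D then 1 else 0)"
      using that by (intro sum.cong) (auto simp: E_def indicator_def)
    also have "\<dots> = real (card {j \<in> J. ok j D})"
      using J(1) by (simp flip: sum.inter_filter)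
    finally show ?thesis .
  qed
  have int: "integrable M (\<lambda>D. \<Sum>j\<in>J. indicat_real (E j) D)"
    using sets by (intro Bochner_Integration.integrable_sum) (simp add: less_top[symmetric])
  have "2 / 3 * real (card J) = (\<Sum>j\<in>J. 2 / 3)"
    by simp
  also have "\<dots> \<le> (\<Sum>j\<in>J. prob (E j))"
    by (intro sum_mono p)
  also have "\<dots> = expectation (\<lambda>D. \<Sum>j\<in>J. indicat_real (E j) D)"
    using sets by (subst Bochner_Integration.integral_sum) (auto simp: less_top[symmetric])
  finally have lower: "2 / 3 * real (card J) \<le> expectation (\<lambda>D. \<Sum>j\<in>J. indicat_real (E j) D)" .
  have "\<exists>D\<in>space M. 2 / 3 * real (card J) \<le> real (card {j \<in> J. ok j D})"
  proof (rule ccontr)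
    assume "\<not> ?thesis"
    then have "AE D in M. (\<Sum>j\<in>J. indicat_real (E j) D) < 2 / 3 * real (card J)"
      by (intro AE_I2) (force simp: count)
    from expectation_less[OF int this] lower show False by simp
  qed
  then show ?thesis
    using that unfolding ok_def by blast
qed

section \<open>Oracles that agree on all queries asked\<close>

lemma queries_result_cong:
  assumes "\<And>S y. (S, y) \<in> set (queries f c) \<Longrightarrow> f' S = f S"
  shows "queries f' c = queries f c \<and> result f' c = result f c"
  using assms
proof (induction c)
  case (Query S c)
  have "f' S = f S"
    using Query.prems[of S "f S"] by simp
  moreover have "queries f' (c (f S)) = queries f (c (f S)) \<and> result f' (c (f S)) = result f (c (f S))"
    using Query.prems by (intro Query.IH) auto
  ultimately show ?case by simp
qed simp

text \<open>Agreement is demanded only on the queries asked under \<open>f\<close>. With the blank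
  function as \<open>f\<close>, one list of queries serves for all hidden functions.\<close>

lemma transcript_cong:
  assumes "\<And>S y. (S, y) \<in> set (transcript D V f us i) \<Longrightarrow> f' S = f S"
  shows "transcript D V f' us i = transcript D V f us i"
  using assms
proof (induction i)
  case (Suc i)
  have "transcript D V f' us i = transcript D V f us i"
    using Suc.prems by (intro Suc.IH) auto
  moreover have "queries f' (D V (length us) (take (Suc i) us) (transcript D V f us i)) =
      queries f (D V (length us) (take (Suc i) us) (transcript D V f us i))"
    using Suc.prems by (intro conjunct1[OF queries_result_cong]) auto
  ultimately show ?case by simp
qed simp

lemma solution_cong:
  assumes "1 \<le> i" "\<And>S y. (S, y) \<in> set (transcript D V f us i) \<Longrightarrow> f' S = f S"
  shows "solution D V f' us i = solution D V f us i"
proof -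
  obtain i' where i: "i = Suc i'"
    using assms(1) by (cases i) auto
  have "transcript D V f' us i' = transcript D V f us i'"
    using assms(2) by (intro transcript_cong) (auto simp: i)
  moreover have "result f' (D V (length us) (take i us) (transcript D V f us i')) =
      result f (D V (length us) (take i us) (transcript D V f us i'))"
    using assms(2) by (intro conjunct2[OF queries_result_cong]) (auto simp: i)
  ultimately show ?thesis
    by (simp add: solution_def i)
qed

lemma transcript_prefix:
  "i \<le> j \<Longrightarrow> \<exists>xs. transcript D V f us j = transcript D V f us i @ xs"
  by (induction j rule: dec_induct) auto

section \<open>Updates and active sets\<close>

lemma foldl_Insert: "foldl apply_update A (map Insert xs) = A \<union> set xs"
  by (induction xs arbitrary: A) auto

lemma foldl_Delete: "foldl apply_update A (map Delete xs) = A - set xs"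
  by (induction xs arbitrary: A) auto

lemma foldl_apply_update_subset: "foldl apply_update A us \<subseteq> A \<union> elem ` set us"
proof (induction us arbitrary: A)
  case (Cons u us)
  show ?case
    using Cons[of "apply_update A u"] by (cases u) auto
qed simp

lemma appeared_subset: "appeared us i \<subseteq> elem ` set (take i us)"
proof -
  have "active us j \<subseteq> elem ` set (take i us)" if "j \<le> i" for j
    using foldl_apply_update_subset[of "{}" "take j us"] set_take_subset_set_take[OF that, of us]
    by (auto simp: active_def)
  then show ?thesis
    by (auto simp: appeared_def)
qed

lemma OPT_ge:
  assumes "finite A" "T \<subseteq> A" "card T \<le> k"
  shows "f T \<le> OPT f k A"
  unfolding OPT_def using assms by (intro Max_ge) auto

section \<open>Uncovered parts as nonnegative, antitone, supermodular functions\<close>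

definition residual :: "(nat set \<Rightarrow> real) \<Rightarrow> bool" where
  "residual g \<longleftrightarrow> (\<forall>S. 0 \<le> g S) \<and> antimono g \<and>
     (\<forall>S T. g S + g T \<le> g (S \<union> T) + g (S \<inter> T))"

lemma residual_const: "0 \<le> c \<Longrightarrow> residual (\<lambda>_. c)"
  by (simp add: residual_def antimono_def)

lemma residual_add: "residual g \<Longrightarrow> residual h \<Longrightarrow> residual (\<lambda>S. g S + h S)"
  unfolding residual_def antimono_def
  by (auto intro: add_mono) (smt (verit, best) add_mono)

text \<open>Measured from the values at the union, supermodularity bounds each factor at the
  intersection below by the sum of both increments. Multiplying these bounds leaves the cross terms
  \<open>a * e + b * c\<close>, which are nonnegative.\<close>

lemma residual_mult:
  assumes g: "residual g" and h: "residual h"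
  shows "residual (\<lambda>S. g S * h S)"
proof -
  have mono: "g T * h T \<le> g S * h S" if "S \<subseteq> T" for S T
    using that g h by (intro mult_mono) (auto simp: residual_def antimono_def)
  have "g S * h S + g T * h T \<le> g (S \<union> T) * h (S \<union> T) + g (S \<inter> T) * h (S \<inter> T)" for S T
  proof -
    define a b where "a = g S - g (S \<union> T)" and "b = g T - g (S \<union> T)"
    define c e where "c = h S - h (S \<union> T)" and "e = h T - h (S \<union> T)"
    have nn: "0 \<le> a" "0 \<le> b" "0 \<le> c" "0 \<le> e" "0 \<le> g (S \<union> T)" "0 \<le> h (S \<union> T)"
      using g h by (auto simp: a_def b_def c_def e_def residual_def antimono_def)
    have "g (S \<union> T) + a + b \<le> g (S \<inter> T)" "h (S \<union> T) + c + e \<le> h (S \<inter> T)"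
      using g h by (auto simp: a_def b_def c_def e_def residual_def algebra_simps)
    then have "(g (S \<union> T) + a + b) * (h (S \<union> T) + c + e) \<le> g (S \<inter> T) * h (S \<inter> T)"
      using nn by (intro mult_mono) auto
    moreover have "(g (S \<union> T) + a + b) * (h (S \<union> T) + c + e) + g (S \<union> T) * h (S \<union> T)
        = g S * h S + g T * h T + a * e + b * c"
      by (simp add: a_def b_def c_def e_def algebra_simps)
    moreover have "0 \<le> a * e" "0 \<le> b * c"
      using nn by auto
    ultimately show ?thesis by linarith
  qed
  then show ?thesis
    using mono g h by (auto simp: residual_def antimono_def)
qed

lemma residual_prod:
  "(\<And>i. i \<in> I \<Longrightarrow> residual (g i)) \<Longrightarrow> residual (\<lambda>S. \<Prod>i\<in>I. g i S)"
  by (induction I rule: infinite_finite_induct) (auto intro: residual_const residual_mult)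

text \<open>The supermodularity gap factors as \<open>q ^ z * (1 - q ^ x) * (1 - q ^ y)\<close>,
  where \<open>z\<close> counts the common and \<open>x\<close>, \<open>y\<close> the exclusive
  elements.\<close>

lemma residual_pow_card:
  assumes "finite A" "0 \<le> q" "q \<le> 1"
  shows "residual (\<lambda>S. q ^ card (S \<inter> A))"
proof -
  have mono: "q ^ card (T \<inter> A) \<le> q ^ card (S \<inter> A)" if "S \<subseteq> T" for S T
    using that assms by (intro power_decreasing card_mono) auto
  have "q ^ card (S \<inter> A) + q ^ card (T \<inter> A) \<le> q ^ card ((S \<union> T) \<inter> A) + q ^ card (S \<inter> T \<inter> A)" for S T
  proof -
    define z x y where "z = card (S \<inter> T \<inter> A)" and "x = card (S \<inter> A - T)" and "y = card (T \<inter> A - S)"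
    have "S \<inter> A = (S \<inter> T \<inter> A) \<union> (S \<inter> A - T)" "T \<inter> A = (S \<inter> T \<inter> A) \<union> (T \<inter> A - S)"
      "(S \<union> T) \<inter> A = (S \<inter> A) \<union> (T \<inter> A - S)"
      by auto
    then have c: "card (S \<inter> A) = z + x" "card (T \<inter> A) = z + y" "card ((S \<union> T) \<inter> A) = card (S \<inter> A) + y"
      unfolding x_def y_def z_def using assms(1)
      by (metis card_Un_disjoint finite_Diff finite_Int Diff_disjoint Int_Diff Int_commute
          Int_left_commute Diff_Int_distrib2)+
    have "0 \<le> q ^ z * ((1 - q ^ x) * (1 - q ^ y))"
      using assms by (intro mult_nonneg_nonneg) (auto simp: power_le_one)
    then show ?thesis
      by (simp add: c flip: z_def) (simp add: power_add algebra_simps)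
  qed
  then show ?thesis
    using mono assms by (auto simp: residual_def antimono_def)
qed

lemma residual_diff_const:
  assumes "residual g" "\<And>S. c \<le> g S"
  shows "residual (\<lambda>S. g S - c)"
  using assms unfolding residual_def antimono_def by (auto simp: algebra_simps)

text \<open>The linear term makes every set of at least \<open>T\<close> elements worth exactly \<open>1\<close>, so that
  queries of large sets reveal nothing.\<close>

definition covered :: "nat \<Rightarrow> (nat set \<Rightarrow> real) \<Rightarrow> nat set \<Rightarrow> real" where
  "covered T g S = min 1 (1 - g S + real (card S) / real T)"

text \<open>The linear term is modular, and truncating a monotone submodular function at a constant
  keeps it submodular. The bound on \<open>g {}\<close> gives nonnegativity.\<close>

lemma dynamic_instance_covered:
  assumes g: "residual g" "g {} \<le> 1"
  shows "dynamic_instance (elem ` set us) (covered T g) us"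
proof -
  let ?V = "elem ` set us"
  let ?h = "\<lambda>S. 1 - g S + real (card S) / real T"
  have anti: "g S' \<le> g S" if "S \<subseteq> S'" for S S'
    using g that by (auto simp: residual_def antimono_def)
  have le1: "g S \<le> 1" for S
    using anti[of "{}" S] g by simp
  have mono: "?h S \<le> ?h S'" if "S \<subseteq> S'" "S' \<subseteq> ?V" for S S'
  proof -
    have "card S \<le> card S'"
      using that by (intro card_mono) (auto intro: finite_subset[of _ ?V])
    then have "real (card S) / real T \<le> real (card S') / real T"
      by (simp add: divide_right_mono)
    then show ?thesis
      using anti[OF that(1)] by simp
  qed
  have sub: "?h (S \<union> S') + ?h (S \<inter> S') \<le> ?h S + ?h S'" if "S \<subseteq> ?V" "S' \<subseteq> ?V" for S S'
  proof -
    have "finite S" "finite S'"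
      using that by (auto intro: finite_subset[of _ ?V])
    then have "real (card (S \<union> S')) + real (card (S \<inter> S')) = real (card S) + real (card S')"
      using card_Un_Int[of S S'] by linarith
    then have "real (card (S \<union> S')) / real T + real (card (S \<inter> S')) / real T =
        real (card S) / real T + real (card S') / real T"
      by (simp flip: add_divide_distrib)
    moreover have "g S + g S' \<le> g (S \<union> S') + g (S \<inter> S')"
      using g by (auto simp: residual_def)
    ultimately show ?thesis by linarith
  qed
  have "nonneg_on ?V (covered T g)"
    using le1 by (auto simp: nonneg_on_def covered_def)
  moreover have "monotone_set_fun ?V (covered T g)"
    unfolding monotone_set_fun_def covered_def by (blast intro: min.mono mono order_refl)
  moreover have "covered T g (S \<union> S') + covered T g (S \<inter> S') \<le> covered T g S + covered T g S'"
    if "S \<subseteq> ?V" "S' \<subseteq> ?V" for S S'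
    using sub[OF that] mono[of S "S \<union> S'"] mono[of S' "S \<union> S'"] mono[of "S \<inter> S'" S] mono[of "S \<inter> S'" S'] that
    by (auto simp: covered_def min_def)
  ultimately show ?thesis
    by (simp add: dynamic_instance_def submodular_def)
qed

section \<open>The hard functions\<close>

text \<open>\<open>d\<close> is the arity and \<open>K\<close> the height of the tree,
  \<open>\<beta> r\<close> the block size at height \<open>r\<close>, \<open>\<eta>\<close> the
  share of a child in the universe of its parent, and \<open>m\<close> scales the number of blocks
  among which one is hidden.\<close>

locale hard_tree =
  fixes d m K :: nat and \<beta> :: "nat \<Rightarrow> nat" and \<eta> :: real
  assumes d_pos: "1 \<le> d" and m_pos: "1 \<le> m" and \<beta>_pos: "\<And>r. 1 \<le> \<beta> r"
    and \<eta>: "0 < \<eta>" "\<eta> < 1"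
begin

text \<open>Node \<open>a < d ^ (K - r)\<close> of height \<open>r\<close> has the children \<open>a * d + c\<close>, \<open>c < d\<close>, of height
  \<open>r - 1\<close>. So the ancestor of height \<open>r\<close> of the leaf \<open>t\<close> is \<open>t div d ^ r\<close>, and the root is the
  node \<open>0\<close> of height \<open>K\<close>.\<close>

definition block :: "nat \<Rightarrow> nat \<Rightarrow> nat \<Rightarrow> nat set" where
  "block r a j = (\<lambda>i. to_nat (r, a, j, i)) ` {..<\<beta> r}"

text \<open>With this count the \<open>d ^ (K - r)\<close> nodes of height \<open>r\<close> hold
  \<open>m * d ^ K\<close> blocks altogether, the same number for every \<open>r\<close>.\<close>

definition blocks :: "nat \<Rightarrow> nat" where
  "blocks r = m * d ^ r"

definition node :: "nat \<Rightarrow> nat \<Rightarrow> nat set" where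
  "node r a = (\<Union>j<blocks r. block r a j)"

definition path :: "nat \<Rightarrow> nat set" where
  "path t = (\<Union>r\<le>K. node r (t div d ^ r))"

lemma blocks_pos: "0 < blocks r"
  using d_pos m_pos by (simp add: blocks_def)

lemma finite_block: "finite (block r a j)"
  by (simp add: block_def)

lemma finite_node: "finite (node r a)"
  by (simp add: node_def finite_block)

lemma card_block: "card (block r a j) = \<beta> r"
  unfolding block_def by (subst card_image) (auto simp: inj_on_def)

lemma card_node_le: "card (node r a) \<le> blocks r * \<beta> r"
proof -
  have "card (node r a) \<le> (\<Sum>j<blocks r. card (block r a j))"
    unfolding node_def by (intro card_UN_le) simp
  then show ?thesis by (simp add: card_block)
qed

lemma block_index: "x \<in> block r a j \<Longrightarrow> fst (snd (snd (from_nat x :: nat \<times> nat \<times> nat \<times> nat))) = j"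
  by (auto simp: block_def)

lemma node_unique: "x \<in> node r a \<Longrightarrow> x \<in> node r' a' \<Longrightarrow> r = r' \<and> a = a'"
  by (auto simp: node_def block_def)

lemma node_disjoint: "(r, a) \<noteq> (r', a') \<Longrightarrow> node r a \<inter> node r' a' = {}"
  by (auto simp: node_def block_def)

lemma block_subset_node: "j < blocks r \<Longrightarrow> block r a j \<subseteq> node r a"
  by (auto simp: node_def)

lemma path_inter_node: "r \<le> K \<Longrightarrow> a \<noteq> t div d ^ r \<Longrightarrow> path t \<inter> node r a = {}"
  by (auto simp: path_def dest: node_unique)

lemma div_power_Suc: "t div d ^ r div d = t div d ^ Suc r"
  by (simp only: power_Suc2 div_mult2_eq)

lemma child_div: "c < d \<Longrightarrow> (a * d + c) div d = a"
  using d_pos by simp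

lemma path_child:
  obtains c where "c < d" "\<And>c'. (t div d ^ Suc r) * d + c' = t div d ^ r \<longleftrightarrow> c' = c"
proof
  show "t div d ^ r mod d < d"
    using d_pos by simp
  have "(t div d ^ Suc r) * d + t div d ^ r mod d = t div d ^ r"
    unfolding div_power_Suc[symmetric] by simp
  then show "(t div d ^ Suc r) * d + c' = t div d ^ r \<longleftrightarrow> c' = t div d ^ r mod d" for c'
    by linarith
qed

text \<open>\<open>\<beta> r\<close> elements of height \<open>r\<close> multiply the uncovered part by \<open>\<eta>\<close>.\<close>

definition q :: "nat \<Rightarrow> real" where
  "q r = root (\<beta> r) \<eta>"

lemma q_pow: "q r ^ \<beta> r = \<eta>"
  using \<beta>_pos[of r] \<eta> by (simp add: q_def)

lemma q_bounds: "0 < q r" "q r \<le> 1"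
  using \<beta>_pos[of r] \<eta> by (auto simp: q_def real_root_gt_zero)

lemma q_pow_ge: "x \<le> \<beta> r \<Longrightarrow> \<eta> \<le> q r ^ x"
  using power_decreasing[of x "\<beta> r" "q r"] q_bounds[of r] by (simp add: q_pow)

text \<open>The part of the universe of node \<open>a\<close> that \<open>S\<close> does not cover. Each child owns an
  \<open>\<eta>\<close>-fraction of the universe of its parent, and the children are independent of each other and
  of the elements of the parent. The exception are the special elements \<open>B r a\<close> of the
  nodes on the path to the leaf \<open>t\<close>: they cover the complement of the fraction owned by the
  child on that path.\<close>

primrec unc :: "nat \<Rightarrow> (nat \<Rightarrow> nat \<Rightarrow> nat set) \<Rightarrow> nat \<Rightarrow> nat \<Rightarrow> nat set \<Rightarrow> real" where
  "unc t B 0 a S = q 0 ^ card (S \<inter> node 0 a)"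
| "unc t B (Suc r) a S = q (Suc r) ^ card (S \<inter> (node (Suc r) a - B (Suc r) a)) *
     (\<Prod>c<d. (if a * d + c = t div d ^ r then q (Suc r) ^ card (S \<inter> B (Suc r) a) else 1)
        - \<eta> + \<eta> * unc t B r (a * d + c) S)"

abbreviation blank :: "nat \<Rightarrow> nat \<Rightarrow> nat set \<Rightarrow> real" where
  "blank \<equiv> unc 0 (\<lambda>_ _. {})"

lemma blank_Suc:
  "blank (Suc r) a S = q (Suc r) ^ card (S \<inter> node (Suc r) a) *
     (\<Prod>c<d. 1 - \<eta> + \<eta> * blank r (a * d + c) S)"
  by (simp cong: if_cong)

declare unc.simps(2) [simp del]

text \<open>One number \<open>h\<close> selects the block at every height. As
  \<open>blocks r\<close> divides \<open>m * d ^ K\<close> for \<open>r \<le> K\<close>, a uniform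
  \<open>h\<close> below \<open>m * d ^ K\<close> makes each single choice uniform.\<close>

definition special :: "nat \<Rightarrow> nat \<Rightarrow> nat \<Rightarrow> nat \<Rightarrow> nat set" where
  "special t h r a = (if a = t div d ^ r then block r a (h mod blocks r) else {})"

abbreviation hidden :: "nat \<Rightarrow> nat \<Rightarrow> nat \<Rightarrow> nat \<Rightarrow> nat set \<Rightarrow> real" where
  "hidden t h \<equiv> unc t (special t h)"

text \<open>A set \<open>B r a\<close> has at most \<open>\<beta> r\<close> elements, so its power
  of \<open>q r\<close> is at least \<open>\<eta>\<close> and subtracting \<open>\<eta>\<close>
  keeps the factor nonnegative. The rest is closure under sums and products.\<close>

lemma residual_unc:
  assumes "\<And>r a. finite (B r a) \<and> card (B r a) \<le> \<beta> r"
  shows "residual (unc t B r a)"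
proof (induction r arbitrary: a)
  case 0
  show ?case
    using residual_pow_card[OF finite_node] q_bounds[of 0] by (simp add: less_imp_le)
next
  case (Suc r)
  have q: "0 \<le> q (Suc r)" "q (Suc r) \<le> 1"
    using q_bounds[of "Suc r"] by auto
  have le: "\<eta> \<le> q (Suc r) ^ card (S \<inter> B (Suc r) a)" for S
    using assms[of "Suc r" a] card_mono[of "B (Suc r) a" "S \<inter> B (Suc r) a"]
    by (intro q_pow_ge) auto
  have "residual (\<lambda>S. (if a * d + c = t div d ^ r then q (Suc r) ^ card (S \<inter> B (Suc r) a) else 1) - \<eta>)" for c
    using assms le \<eta> q by (cases "a * d + c = t div d ^ r")
      (auto intro!: residual_diff_const residual_pow_card residual_const)
  then show ?case
    using q finite_node unfolding unc.simps
    by (intro residual_mult residual_pow_card residual_prod residual_add residual_const Suc)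
      (use \<eta> in auto)
qed

lemma residual_blank: "residual (blank r a)"
  by (intro residual_unc) auto

lemma residual_hidden: "residual (hidden t h r a)"
  by (intro residual_unc) (auto simp: special_def finite_block card_block)

primrec avoids :: "nat \<Rightarrow> nat \<Rightarrow> nat set \<Rightarrow> bool" where
  "avoids 0 a S \<longleftrightarrow> S \<inter> node 0 a = {}"
| "avoids (Suc r) a S \<longleftrightarrow> S \<inter> node (Suc r) a = {} \<and> (\<forall>c<d. avoids r (a * d + c) S)"

lemma unc_avoids:
  assumes "\<And>r a. B r a \<subseteq> node r a"
  shows "avoids r a S \<Longrightarrow> unc t B r a S = 1"
proof (induction r arbitrary: a)
  case (Suc r)
  have "S \<inter> (node (Suc r) a - B (Suc r) a) = {}" "S \<inter> B (Suc r) a = {}"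
    using Suc.prems assms[of "Suc r" a] by auto
  then show ?case
    using Suc by (auto simp: unc.simps intro: prod.neutral)
qed simp

lemma special_subset: "special t h r a \<subseteq> node r a"
  using block_subset_node blocks_pos by (auto simp: special_def)

lemma avoids_empty: "avoids r a {}"
  by (induction r arbitrary: a) auto

lemma blank_avoids: "avoids r a S \<Longrightarrow> blank r a S = 1"
  by (rule unc_avoids) auto

lemma hidden_avoids: "avoids r a S \<Longrightarrow> hidden t h r a S = 1"
  by (rule unc_avoids) (auto simp: special_subset[THEN subsetD])

text \<open>If \<open>S\<close> misses the special block, the two recursions coincide. If
  \<open>S\<close> avoids the subtree of the child on the path, special elements act like ordinary
  ones, since their power of \<open>q\<close> can be moved out of the product.\<close>

lemma hidden_eq_blank:
  assumes "\<And>r. r < K \<Longrightarrow>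
      S \<inter> special t h (Suc r) (t div d ^ Suc r) = {} \<or> avoids r (t div d ^ r) S"
  shows "r \<le> K \<Longrightarrow> hidden t h r a S = blank r a S"
proof (induction r arbitrary: a)
  case (Suc r)
  define B where "B = special t h (Suc r) a"
  have IH: "hidden t h r a' S = blank r a' S" for a'
    using Suc by simp
  have B: "B \<subseteq> node (Suc r) a"
    by (simp add: B_def special_subset)
  have hid: "hidden t h (Suc r) a S = q (Suc r) ^ card (S \<inter> (node (Suc r) a - B)) *
      (\<Prod>c<d. (if a * d + c = t div d ^ r then q (Suc r) ^ card (S \<inter> B) else 1)
        - \<eta> + \<eta> * blank r (a * d + c) S)"
    by (simp only: unc.simps(2) IH B_def)
  show ?case
  proof (cases "S \<inter> B = {}")
    case True
    then have S: "S \<inter> (node (Suc r) a - B) = S \<inter> node (Suc r) a"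
      by auto
    have "(\<Prod>c<d. (if a * d + c = t div d ^ r then q (Suc r) ^ card (S \<inter> B) else 1)
        - \<eta> + \<eta> * blank r (a * d + c) S) = (\<Prod>c<d. 1 - \<eta> + \<eta> * blank r (a * d + c) S)"
      using True by (intro prod.cong) auto
    then show ?thesis
      unfolding blank_Suc hid by (simp add: S)
  next
    case False
    then have a: "a = t div d ^ Suc r"
      by (auto simp: B_def special_def split: if_splits)
    have av: "avoids r (t div d ^ r) S"
      using assms[of r] Suc.prems False by (auto simp: B_def a)
    obtain c where "c < d" "\<And>c'. (t div d ^ Suc r) * d + c' = t div d ^ r \<longleftrightarrow> c' = c"
      using path_child by metis
    note c = this[folded a]
    then have c': "a * d + c = t div d ^ r"
      by blast
    let ?g = "\<lambda>c. 1 - \<eta> + \<eta> * blank r (a * d + c) S"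
    \<comment> \<open>The child on the path is entirely uncovered, so in its factor
      \<open>- \<eta> + \<eta> * 1\<close> cancels and only the power of \<open>q\<close>
      remains.\<close>
    have "(\<Prod>c'<d. (if a * d + c' = t div d ^ r then q (Suc r) ^ card (S \<inter> B) else 1)
        - \<eta> + \<eta> * blank r (a * d + c') S) = q (Suc r) ^ card (S \<inter> B) * (\<Prod>c'\<in>{..<d} - {c}. ?g c')"
      using c(1) av by (subst prod.remove[of _ c]) (auto simp: c(2) c' blank_avoids intro!: prod.cong)
    moreover have "(\<Prod>c'<d. ?g c') = (\<Prod>c'\<in>{..<d} - {c}. ?g c')"
      using c(1) av by (subst prod.remove[of _ c]) (auto simp: c' blank_avoids)
    moreover have "card (S \<inter> node (Suc r) a) = card (S \<inter> (node (Suc r) a - B)) + card (S \<inter> B)"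
      using B finite_node[of "Suc r" a] finite_subset[OF B]
      by (subst card_Un_disjoint[symmetric]) (auto intro: arg_cong[of _ _ card])
    ultimately show ?thesis
      unfolding blank_Suc hid by (simp add: power_add)
  qed
qed simp

lemma path_avoids: "S \<subseteq> path t \<Longrightarrow> r \<le> K \<Longrightarrow> a \<noteq> t div d ^ r \<Longrightarrow> avoids r a S"
proof (induction r arbitrary: a)
  case 0
  then show ?case
    using path_inter_node[of 0 a t] by auto
next
  case (Suc r)
  have "a * d + c \<noteq> t div d ^ r" if "c < d" for c
    using Suc.prems(3) child_div[OF that, of a] div_power_Suc[of t r] by metis
  then show ?case
    using Suc path_inter_node[of "Suc r" a t] by auto
qed

lemma blank_path_Suc:
  assumes "S \<subseteq> path t" "r < K"
  shows "blank (Suc r) (t div d ^ Suc r) S = q (Suc r) ^ card (S \<inter> node (Suc r) (t div d ^ Suc r)) *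
    (1 - \<eta> + \<eta> * blank r (t div d ^ r) S)"
proof -
  let ?a = "t div d ^ Suc r"
  obtain c where c: "c < d" "\<And>c'. ?a * d + c' = t div d ^ r \<longleftrightarrow> c' = c"
    using path_child by metis
  then have c': "?a * d + c = t div d ^ r"
    by blast
  have "blank r (?a * d + c') S = 1" if "c' \<noteq> c" for c'
    using that assms c(2) by (intro blank_avoids path_avoids) auto
  then have "(\<Prod>c'\<in>{..<d} - {c}. 1 - \<eta> + \<eta> * blank r (?a * d + c') S) = 1"
    by (intro prod.neutral) auto
  then show ?thesis
    using c(1) unfolding blank_Suc by (subst prod.remove[of _ c]) (auto simp only: c' finite_lessThan lessThan_iff mult_1_right)
qed

text \<open>A full special block contributes \<open>q ^ \<beta> = \<eta>\<close>, which cancels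
  \<open>- \<eta>\<close> in the factor of the child on the path. All other children are untouched
  and contribute 1.\<close>

lemma hidden_path_Suc:
  assumes "S \<subseteq> path t" "r < K" "S \<inter> node (Suc r) (t div d ^ Suc r) = special t h (Suc r) (t div d ^ Suc r)"
  shows "hidden t h (Suc r) (t div d ^ Suc r) S = \<eta> * hidden t h r (t div d ^ r) S"
proof -
  let ?a = "t div d ^ Suc r"
  let ?g = "\<lambda>c'. (if ?a * d + c' = t div d ^ r then q (Suc r) ^ card (S \<inter> special t h (Suc r) ?a) else 1)
        - \<eta> + \<eta> * hidden t h r (?a * d + c') S"
  obtain c where c: "c < d" "\<And>c'. ?a * d + c' = t div d ^ r \<longleftrightarrow> c' = c"
    using path_child by metis
  then have c': "?a * d + c = t div d ^ r"
    by blast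
  have "hidden t h r (?a * d + c') S = 1" if "c' \<noteq> c" for c'
    using that assms c(2) by (intro hidden_avoids path_avoids) auto
  then have "(\<Prod>c'\<in>{..<d} - {c}. ?g c') = 1"
    using c(2) by (intro prod.neutral) auto
  moreover have "S \<inter> (node (Suc r) ?a - special t h (Suc r) ?a) = {}"
    "S \<inter> special t h (Suc r) ?a = block (Suc r) ?a (h mod blocks (Suc r))"
    using assms(3) special_subset[of t h "Suc r" ?a] by (auto simp: special_def)
  then have "q (Suc r) ^ card (S \<inter> (node (Suc r) ?a - special t h (Suc r) ?a)) = 1"
    "?g c = \<eta> * hidden t h r (t div d ^ r) S"
    by (simp_all only: c' card_block q_pow card.empty power_0 if_True diff_self add_0 refl)
  ultimately show ?thesis
    using c(1) unfolding unc.simps by (subst prod.remove[of _ c]) (auto simp only: finite_lessThan lessThan_iff mult_1_right mult_1_left)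
qed

text \<open>The planted solution: each of the \<open>Suc K\<close> heights contributes a factor
  \<open>\<eta>\<close>, the leaf because it too receives a block of \<open>\<beta> 0\<close>
  elements.\<close>

lemma hidden_special_path:
  fixes h
  assumes "t < d ^ K"
  defines "S \<equiv> (\<Union>r\<le>K. special t h r (t div d ^ r))"
  shows "S \<subseteq> path t" "card S \<le> (\<Sum>r\<le>K. \<beta> r)" "hidden t h K 0 S = \<eta> ^ Suc K"
proof -
  show sub: "S \<subseteq> path t"
    using special_subset by (fastforce simp: S_def path_def)
  have "card S \<le> (\<Sum>r\<le>K. card (special t h r (t div d ^ r)))"
    unfolding S_def by (intro card_UN_le) simp
  also have "\<dots> = (\<Sum>r\<le>K. \<beta> r)"
    by (simp add: special_def card_block)
  finally show "card S \<le> (\<Sum>r\<le>K. \<beta> r)" .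
  have inter: "S \<inter> node r (t div d ^ r) = special t h r (t div d ^ r)" if "r \<le> K" for r
  proof -
    have "special t h r' (t div d ^ r') \<inter> node r (t div d ^ r) = {}" if "r' \<noteq> r" for r'
      using special_subset[of t h r' "t div d ^ r'"] node_disjoint[of r' "t div d ^ r'" r "t div d ^ r"] that
      by auto
    then show ?thesis
      using that special_subset[of t h r "t div d ^ r"] unfolding S_def by fastforce
  qed
  have "hidden t h r (t div d ^ r) S = \<eta> ^ Suc r" if "r \<le> K" for r
    using that
  proof (induction r)
    case 0
    then show ?case
      using inter[of 0] by (simp add: special_def card_block q_pow)
  next
    case (Suc r)
    then show ?case
      using hidden_path_Suc[OF sub _ inter[of "Suc r"]] by simp
  qed
  from this[of K] show "hidden t h K 0 S = \<eta> ^ Suc K"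
    using assms by simp
qed

text \<open>The nodes whose subtrees the depth-first traversal has entered by segment
  \<open>t\<close>; they bound what may be queried up to the end of that segment.\<close>

definition reached :: "nat \<Rightarrow> nat set" where
  "reached t = {x. \<exists>r\<le>K. \<exists>a\<le>t div d ^ r. x \<in> node r a}"

lemma reached_inter_node:
  assumes "S \<subseteq> reached t" "t div d ^ r < a"
  shows "S \<inter> node r a = {}"
  using assms unfolding reached_def by (fastforce dest: node_unique)

text \<open>A node to the right of the current ancestor at its height has only descendants to the
  right of the current ancestors at theirs.\<close>

lemma reached_avoids: "S \<subseteq> reached t \<Longrightarrow> t div d ^ r < a \<Longrightarrow> avoids r a S"
proof (induction r arbitrary: a)
  case 0
  then show ?case
    using reached_inter_node[of S t 0 a] by simp
next
  case (Suc r)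
  have "t div d ^ r < a * d + c" for c
  proof -
    have "x < (x div d + 1) * d" for x
      using dividend_less_div_times[of d x] d_pos by simp
    then have "t div d ^ r < (t div d ^ r div d + 1) * d" .
    also have "\<dots> \<le> a * d"
      using Suc.prems(2) unfolding div_power_Suc by (intro mult_right_mono) auto
    finally show ?thesis by simp
  qed
  then show ?case
    using Suc reached_inter_node[of S t "Suc r" a] by auto
qed

end

section \<open>The stream\<close>

context hard_tree begin

definition node_list :: "nat \<Rightarrow> nat \<Rightarrow> nat list" where
  "node_list r a = sorted_list_of_set (node r a)"

definition node_lists :: "(nat \<Rightarrow> bool) \<Rightarrow> nat \<Rightarrow> nat list" where
  "node_lists P t = concat (map (\<lambda>r. if P r then node_list r (t div d ^ r) else []) [0..<Suc K])"

text \<open>During segment \<open>t\<close> the elements of \<open>path t\<close> are active at some point. A node is inserted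
  in the first segment and deleted in the last segment of the leaves below it.\<close>

definition insertions :: "nat \<Rightarrow> update list" where
  "insertions t = map Insert (node_lists (\<lambda>r. d ^ r dvd t) t)"

definition deletions :: "nat \<Rightarrow> update list" where
  "deletions t = map Delete (node_lists (\<lambda>r. d ^ r dvd Suc t) t)"

definition segments :: "nat \<Rightarrow> update list" where
  "segments t = concat (map (\<lambda>t. insertions t @ deletions t) [0..<t])"

lemma set_node_list: "set (node_list r a) = node r a"
  by (simp add: node_list_def finite_node)

lemma set_node_lists: "set (node_lists P t) = (\<Union>r\<in>{r. r \<le> K \<and> P r}. node r (t div d ^ r))"
  by (force simp: node_lists_def set_node_list less_Suc_eq_le simp del: upt_Suc split: if_splits)

lemma elem_Insert_Delete: "elem ` set (map Insert xs) = set xs" "elem ` set (map Delete xs) = set xs"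
  by force+

lemma length_node_list_le: "length (node_list r a) \<le> blocks r * \<beta> r"
  by (simp add: node_list_def card_node_le)

lemma segments_Suc: "segments (Suc t) = segments t @ insertions t @ deletions t"
  by (simp add: segments_def)

lemma segments_0: "segments 0 = []"
  by (simp add: segments_def)

lemma div_Suc_eq: "\<not> p dvd Suc t \<Longrightarrow> Suc t div p = t div p" for p :: nat
  by (simp add: div_Suc dvd_eq_mod_eq_0)

text \<open>Segment \<open>t\<close> deletes exactly the nodes of its path for which
  \<open>t\<close> is the last leaf. For the surviving heights \<open>t\<close> and
  \<open>Suc t\<close> have the same ancestor.\<close>

lemma active_segments:
  "foldl apply_update {} (segments t) = (\<Union>r\<in>{r. r \<le> K \<and> \<not> d ^ r dvd t}. node r (t div d ^ r))"
  "foldl apply_update {} (segments t @ insertions t) = path t"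
proof (induction t)
  case 0
  show "foldl apply_update {} (segments 0) = (\<Union>r\<in>{r. r \<le> K \<and> \<not> d ^ r dvd 0}. node r (0 div d ^ r))"
    by (simp add: segments_0)
  show "foldl apply_update {} (segments 0 @ insertions 0) = path 0"
    by (auto simp: segments_0 insertions_def foldl_Insert set_node_lists path_def)
next
  case (Suc t)
  have "foldl apply_update {} (segments (Suc t)) =
      path t - (\<Union>r\<in>{r. r \<le> K \<and> d ^ r dvd Suc t}. node r (t div d ^ r))"
    using Suc(2) by (auto simp: segments_Suc deletions_def foldl_Delete set_node_lists)
  also have "\<dots> = (\<Union>r\<in>{r. r \<le> K \<and> \<not> d ^ r dvd Suc t}. node r (t div d ^ r))"
    by (auto simp: path_def dest: node_unique)
  also have "\<dots> = (\<Union>r\<in>{r. r \<le> K \<and> \<not> d ^ r dvd Suc t}. node r (Suc t div d ^ r))"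
    by (simp add: div_Suc_eq)
  finally show *: "foldl apply_update {} (segments (Suc t)) =
      (\<Union>r\<in>{r. r \<le> K \<and> \<not> d ^ r dvd Suc t}. node r (Suc t div d ^ r))" .
  show "foldl apply_update {} (segments (Suc t) @ insertions (Suc t)) = path (Suc t)"
    by (auto simp: foldl_append * insertions_def foldl_Insert set_node_lists path_def)
qed

lemma elem_segments: "elem ` set (segments (Suc t)) \<subseteq> reached t"
proof (induction t)
  case 0
  have "elem ` set (insertions 0 @ deletions 0) \<subseteq> reached 0"
    unfolding set_append image_Un insertions_def deletions_def elem_Insert_Delete set_node_lists reached_def
    by auto
  then show ?case
    by (simp add: segments_Suc segments_0)
next
  case (Suc t)
  have "t div d ^ r \<le> Suc t div d ^ r" for r
    by (simp add: div_le_mono)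
  then have "reached t \<subseteq> reached (Suc t)"
    unfolding reached_def by (blast intro: order_trans)
  moreover have "elem ` set (insertions (Suc t) @ deletions (Suc t)) \<subseteq> reached (Suc t)"
    unfolding set_append image_Un insertions_def deletions_def elem_Insert_Delete set_node_lists reached_def
    by auto
  ultimately show ?case
    using Suc unfolding segments_Suc[of "Suc t"] by auto
qed

text \<open>The leaf is always inserted, since \<open>d ^ 0\<close> divides \<open>t\<close>. Hence
  the round that ends the insertions has index at least 1.\<close>

lemma insertions_nonempty: "insertions t \<noteq> []"
proof -
  have "node 0 t \<noteq> {}"
    using blocks_pos[of 0] \<beta>_pos[of 0] by (auto simp: node_def block_def lessThan_empty_iff bot_nat_def)
  then have "set (node_lists (\<lambda>r. d ^ r dvd t) t) \<noteq> {}"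
    unfolding set_node_lists by fastforce
  then show ?thesis
    by (auto simp: insertions_def)
qed

text \<open>The two conditions single out the first and the last leaf below a node of height
  \<open>r\<close>, so each node is counted at most once.\<close>

lemma card_multiples_le: "r \<le> K \<Longrightarrow> card {t. t < d ^ K \<and> d ^ r dvd t} \<le> d ^ (K - r)"
  "r \<le> K \<Longrightarrow> card {t. t < d ^ K \<and> d ^ r dvd Suc t} \<le> d ^ (K - r)"
proof -
  assume r: "r \<le> K"
  have lt: "t div d ^ r < d ^ (K - r)" if "t < d ^ K" for t
    using that r by (simp add: less_mult_imp_div_less flip: power_add)
  have "inj_on (\<lambda>t. t div d ^ r) {t. t < d ^ K \<and> d ^ r dvd t}"
    by (rule inj_onI) (metis (mono_tags, lifting) dvd_mult_div_cancel mem_Collect_eq)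
  from card_inj_on_le[OF this, of "{..<d ^ (K - r)}"]
  show "card {t. t < d ^ K \<and> d ^ r dvd t} \<le> d ^ (K - r)"
    using lt by auto
  have suc: "Suc t = d ^ r * Suc (t div d ^ r)" if dvd: "d ^ r dvd Suc t" for t
  proof -
    have "Suc t div d ^ r = Suc (t div d ^ r)"
      using dvd by (simp add: div_Suc dvd_eq_mod_eq_0)
    then show ?thesis
      using dvd_mult_div_cancel[OF dvd] by simp
  qed
  have "inj_on (\<lambda>t. t div d ^ r) {t. t < d ^ K \<and> d ^ r dvd Suc t}"
    by (rule inj_onI) (metis (mono_tags, lifting) suc mem_Collect_eq nat.inject)
  from card_inj_on_le[OF this, of "{..<d ^ (K - r)}"]
  show "card {t. t < d ^ K \<and> d ^ r dvd Suc t} \<le> d ^ (K - r)"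
    using lt by auto
qed

lemma length_segments_le:
  assumes "(\<Sum>r\<le>K. \<beta> r) \<le> k"
  shows "length (segments (d ^ K)) \<le> 2 * m * d ^ K * k"
proof -
  let ?N = "\<lambda>P. \<Sum>t<d ^ K. \<Sum>r\<le>K. if P t r then blocks r * \<beta> r else 0"
  have count: "?N P \<le> m * d ^ K * k"
    if P: "\<And>r. r \<le> K \<Longrightarrow> card {t. t < d ^ K \<and> P t r} \<le> d ^ (K - r)" for P
  proof -
    have "?N P = (\<Sum>r\<le>K. \<Sum>t<d ^ K. if P t r then blocks r * \<beta> r else 0)"
      by (rule sum.swap)
    also have "\<dots> = (\<Sum>r\<le>K. card {t. t < d ^ K \<and> P t r} * (blocks r * \<beta> r))"
      by (intro sum.cong refl) (simp flip: sum.inter_filter add: lessThan_def)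
    also have "\<dots> \<le> (\<Sum>r\<le>K. d ^ (K - r) * (blocks r * \<beta> r))"
      using P by (intro sum_mono mult_right_mono) auto
    also have "\<dots> = (\<Sum>r\<le>K. m * d ^ K * \<beta> r)"
    proof (intro sum.cong refl)
      fix r assume "r \<in> {..K}"
      then have "d ^ (K - r) * d ^ r = d ^ K"
        by (simp flip: power_add)
      then show "d ^ (K - r) * (blocks r * \<beta> r) = m * d ^ K * \<beta> r"
        by (metis blocks_def mult.assoc mult.commute)
    qed
    also have "\<dots> \<le> m * d ^ K * k"
      using assms by (simp flip: sum_distrib_left)
    finally show ?thesis .
  qed
  have len: "length (node_lists P t) \<le> (\<Sum>r\<le>K. if P r then blocks r * \<beta> r else 0)" for P t
    unfolding node_lists_def length_concat map_map comp_def interv_sum_list_conv_sum_set_nat set_upt atLeast0LessThan lessThan_Suc_atMost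
    by (intro sum_mono) (simp add: length_node_list_le)
  have "length (segments N) \<le> (\<Sum>t<N. (\<Sum>r\<le>K. if d ^ r dvd t then blocks r * \<beta> r else 0) +
      (\<Sum>r\<le>K. if d ^ r dvd Suc t then blocks r * \<beta> r else 0))" for N
  proof (induction N)
    case (Suc N)
    then show ?case
      using len[of "\<lambda>r. d ^ r dvd N" N] len[of "\<lambda>r. d ^ r dvd Suc N" N]
      unfolding segments_Suc insertions_def deletions_def length_append length_map sum.lessThan_Suc by linarith
  qed (simp add: segments_0)
  from this[of "d ^ K"] show ?thesis
    using count[of "\<lambda>t r. d ^ r dvd t"] count[of "\<lambda>t r. d ^ r dvd Suc t"] card_multiples_le
    unfolding sum.distrib by fastforce
qed

end

section \<open>The number of queries on the blank instance\<close>

lemma card_div_eq_le: "0 < p \<Longrightarrow> finite {t::nat. t div p = u} \<and> card {t. t div p = u} \<le> p"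
proof -
  assume p: "0 < p"
  have sub: "{t. t div p = u} \<subseteq> {u * p..<u * p + p}"
  proof
    fix t assume "t \<in> {t. t div p = u}"
    then have "t = u * p + t mod p"
      using div_mult_mod_eq[of t p] by simp
    then show "t \<in> {u * p..<u * p + p}"
      using mod_less_divisor[OF p, of t] by (metis add_less_cancel_left atLeastLessThan_iff le_add1)
  qed
  show ?thesis
    using card_mono[OF _ sub] finite_subset[OF sub] by simp
qed

lemma card_mod_in_le:
  fixes X :: "nat set"
  assumes "finite X"
  shows "card {h. h < a * b \<and> h mod a \<in> X} \<le> b * card X"
proof -
  have "inj_on (\<lambda>h. (h div a, h mod a)) {h. h < a * b \<and> h mod a \<in> X}"
    by (rule inj_onI) (metis div_mult_mod_eq prod.inject)
  then have "card {h. h < a * b \<and> h mod a \<in> X} \<le> card ({..<b} \<times> X)"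
    by (rule card_inj_on_le) (auto simp: assms less_mult_imp_div_less mult.commute)
  then show ?thesis
    by (simp add: card_cartesian_product)
qed

lemma covered_large:
  assumes "residual g" "g {} \<le> 1" "T \<le> card S" "1 \<le> T"
  shows "covered T g S = 1"
proof -
  have "g S \<le> 1"
    using assms(1,2) unfolding residual_def antimono_def by (meson empty_subsetI order_trans)
  moreover have "1 \<le> real (card S) / real T"
    using assms by simp
  ultimately show ?thesis
    by (simp add: covered_def)
qed

context hard_tree begin

lemma segments_prefix: "t \<le> t' \<Longrightarrow> \<exists>xs. segments t' = segments t @ xs"
  by (induction t' rule: dec_induct) (auto simp: segments_Suc)

text \<open>There are at most \<open>d ^ r\<close> leaves \<open>t\<close> below the same child,
  fewer than \<open>T\<close> block indices met by \<open>S\<close>, and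
  \<open>d ^ (K - Suc r)\<close> values of \<open>h\<close> per index. Counting leaves below the
  child instead of its parent gains the decisive factor \<open>d\<close>.\<close>

lemma card_hit_le:
  assumes "finite S" "card S < T" "r < K"
  shows "card {(t, h) \<in> {..<d ^ K} \<times> {..<m * d ^ K}. t div d ^ r = t' div d ^ r \<and>
      S \<inter> special t h (Suc r) (t div d ^ Suc r) \<noteq> {}} \<le> T * d ^ (K - 1)"
proof -
  define X where "X = {j. S \<inter> block (Suc r) (t' div d ^ Suc r) j \<noteq> {}}"
  have "X \<subseteq> (\<lambda>x. fst (snd (snd (from_nat x :: nat \<times> nat \<times> nat \<times> nat)))) ` S"
    unfolding X_def by (auto simp: image_iff dest!: block_index)
  then have X: "finite X" "card X \<le> card S"
    using assms(1) by (auto intro: finite_subset finite_imageI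
        order_trans[OF card_mono card_image_le])
  have p: "0 < d ^ r"
    using d_pos by simp
  have m: "m * d ^ K = blocks (Suc r) * d ^ (K - Suc r)"
    using assms(3) unfolding blocks_def mult.assoc power_add[symmetric] by simp
  let ?H = "{h. h < m * d ^ K \<and> h mod blocks (Suc r) \<in> X}"
  have H: "card ?H \<le> d ^ (K - Suc r) * card X"
    unfolding m by (rule card_mod_in_le[OF X(1)])
  have parent: "t div d ^ Suc r = t' div d ^ Suc r" if "t div d ^ r = t' div d ^ r" for t
    using that by (metis div_power_Suc)
  let ?A = "{(t, h) \<in> {..<d ^ K} \<times> {..<m * d ^ K}. t div d ^ r = t' div d ^ r \<and>
      S \<inter> special t h (Suc r) (t div d ^ Suc r) \<noteq> {}}"
  have "?A \<subseteq> {t. t div d ^ r = t' div d ^ r} \<times> ?H"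
  proof
    fix z assume "z \<in> ?A"
    then obtain t h where z: "z = (t, h)" "t div d ^ r = t' div d ^ r" "h < m * d ^ K"
      and hits: "S \<inter> special t h (Suc r) (t div d ^ Suc r) \<noteq> {}"
      by auto
    from hits have "h mod blocks (Suc r) \<in> X"
      unfolding special_def parent[OF z(2)] X_def by simp
    then show "z \<in> {t. t div d ^ r = t' div d ^ r} \<times> ?H"
      using z by simp
  qed
  then have "card ?A \<le> card ({t. t div d ^ r = t' div d ^ r} \<times> ?H)"
    using card_div_eq_le[OF p] by (intro card_mono) auto
  also have "\<dots> \<le> d ^ r * (d ^ (K - Suc r) * card X)"
    unfolding card_cartesian_product using card_div_eq_le[OF p] H by (intro mult_mono) auto
  also have "\<dots> = d ^ (K - 1) * card X"
    using assms(3) by (simp flip: mult.assoc power_add)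
  also have "\<dots> \<le> T * d ^ (K - 1)"
    using X assms(2) by (simp add: mult.commute)
  finally show ?thesis .
qed

text \<open>A pair \<open>(t, h)\<close> that no blank query reveals makes the algorithm act as on
  the blank instance, so it fails when \<open>path t\<close> is active. Success on two thirds of the
  pairs thus forces many revealed pairs, and each query reveals few.\<close>

lemma query_lower_bound:
  fixes k T n :: nat
  assumes T: "1 \<le> T" and K: "1 \<le> K" and m: "m = 6 * K * T" and \<beta>: "(\<Sum>r\<le>K. \<beta> r) \<le> k"
    and n: "2 * m * d ^ K * k \<le> n" and \<gamma>: "0 \<le> \<gamma>"
    and hard: "\<And>t S. t < d ^ K \<Longrightarrow> S \<subseteq> path t \<Longrightarrow> card S \<le> k \<Longrightarrow>
      covered T (blank K 0) S < \<gamma> * (1 - \<eta> ^ Suc K)"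
    and M: "randomized_algorithm k M" "achieves_ratio k M \<gamma>" "amortized_query_complexity M Q"
  shows "real (d ^ Suc K) \<le> real n * Q n"
proof -
  \<comment> \<open>The padding brings the length to exactly \<open>n\<close>; only rounds before it
    are examined for failure.\<close>
  define us where "us = segments (d ^ K) @ replicate (n - length (segments (d ^ K))) (Delete 0)"
  define V where "V = elem ` set us"
  define J where "J = {..<d ^ K} \<times> {..<m * d ^ K}"
  define f where "f = (\<lambda>(t, h). covered T (hidden t h K 0))"
  define f0 where "f0 = covered T (blank K 0)"
  have len: "length us = n"
    using length_segments_le[OF \<beta>] n by (simp add: us_def)
  have blank1: "blank K 0 {} \<le> 1" and hidden1: "hidden t h K 0 {} \<le> 1" for t h
    using blank_avoids[OF avoids_empty] hidden_avoids[OF avoids_empty] by auto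
  have inst: "dynamic_instance V (f j) us" for j
    unfolding V_def f_def by (cases j) (auto intro: dynamic_instance_covered residual_hidden hidden1)
  have inst0: "dynamic_instance V f0 us"
    unfolding V_def f0_def by (intro dynamic_instance_covered residual_blank blank1)
  have J: "finite J" "J \<noteq> {}" "card J = d ^ K * (m * d ^ K)"
    using d_pos m_pos by (auto simp: J_def card_cartesian_product lessThan_empty_iff bot_nat_def)
  obtain D where D: "D \<in> space M"
    "2 / 3 * real (card J) \<le> real (card {j \<in> J. \<forall>i\<in>{1..length us}.
        \<gamma> * OPT (f j) k (active us i) \<le> f j (solution D V (f j) us i)})"
    by (rule sample_algorithm[where V = "\<lambda>_. V" and f = f and us = "\<lambda>_. us", OF M(1,2) J(1,2) inst])
  have feasible: "feasible_algorithm k D"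
    using M(1) D(1) by (simp add: randomized_algorithm_def)

  define b where "b t = length (segments t)" for t
  define \<tau> where "\<tau> t = length (segments t @ insertions t)" for t
  have us_Suc: "\<exists>xs. us = segments t @ insertions t @ deletions t @ xs" if "t < d ^ K" for t
    using segments_prefix[of "Suc t" "d ^ K"] that by (auto simp: us_def segments_Suc)
  have take_\<tau>: "take (\<tau> t) us = segments t @ insertions t" if "t < d ^ K" for t
    using us_Suc[OF that] by (auto simp: \<tau>_def)
  have take_b: "take (b (Suc t)) us = segments (Suc t)" if "t < d ^ K" for t
    using us_Suc[OF that] by (auto simp: b_def segments_Suc)
  have \<tau>_le: "1 \<le> \<tau> t" "\<tau> t \<le> b (Suc t)" "b (Suc t) \<le> length us" if "t < d ^ K" for t
    using us_Suc[OF that] insertions_nonempty[of t]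
    by (auto simp: \<tau>_def b_def segments_Suc Suc_le_eq)
  have active_\<tau>: "active us (\<tau> t) = path t" if "t < d ^ K" for t
    unfolding active_def take_\<tau>[OF that] by (rule active_segments(2))
  have appeared_b: "appeared us (b (Suc t)) \<subseteq> reached t" if "t < d ^ K" for t
    using appeared_subset[of us "b (Suc t)"] elem_segments[of t] unfolding take_b[OF that] by blast

  define tr where "tr t = transcript D V f0 us (b t)" for t
  \<comment> \<open>The output at round \<open>\<tau> t\<close> is treated as one more query, so
    that its hidden value is also known to equal the blank one.\<close>
  define Qs where "Qs t = insert (solution D V f0 us (\<tau> t)) (fst ` set (drop (length (tr t)) (tr (Suc t))))" for t
  have tr_Suc: "tr (Suc t) = tr t @ drop (length (tr t)) (tr (Suc t))" for t
  proof -
    have "b t \<le> b (Suc t)"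
      by (simp add: b_def segments_Suc)
    from transcript_prefix[OF this, of D V f0 us] show ?thesis
      by (auto simp: tr_def)
  qed
  have tr_queries: "fst ` set (tr t) \<subseteq> (\<Union>t'<t. Qs t')" for t
  proof (induction t)
    case 0
    then show ?case
      by (simp add: tr_def b_def segments_0)
  next
    case (Suc t)
    have "fst ` set (tr (Suc t)) \<subseteq> fst ` set (tr t) \<union> Qs t"
      by (subst tr_Suc) (auto simp: Qs_def simp del: drop_append)
    then show ?case
      using Suc by (auto simp: lessThan_Suc)
  qed
  have card_Qs: "(\<Sum>t<N. card (Qs t)) \<le> length (tr N) + N" for N
  proof (induction N)
    case (Suc N)
    have "card (Qs N) \<le> Suc (card (fst ` set (drop (length (tr N)) (tr (Suc N)))))"
      by (simp add: Qs_def card_insert_if)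
    also have "card (fst ` set (drop (length (tr N)) (tr (Suc N)))) \<le> length (drop (length (tr N)) (tr (Suc N)))"
      by (meson card_image_le card_length finite_set order_trans)
    also have "length (drop (length (tr N)) (tr (Suc N))) = length (tr (Suc N)) - length (tr N)"
      by simp
    finally have "card (Qs N) \<le> Suc (length (tr (Suc N)) - length (tr N))"
      by simp
    moreover have "length (tr N) \<le> length (tr (Suc N))"
      by (metis tr_Suc length_append le_add1)
    ultimately show ?case
      using Suc by simp
  qed simp
  have Qs_reached: "S \<subseteq> reached t" if t: "t < d ^ K" and S: "S \<in> Qs t" for t S
  proof (cases "S = solution D V f0 us (\<tau> t)")
    case True
    then have "S \<subseteq> path t"
      using feasible inst0 \<tau>_le[OF t] active_\<tau>[OF t]
      unfolding feasible_algorithm_def by fastforce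
    then show ?thesis
      unfolding path_def reached_def by blast
  next
    case False
    then have "S \<in> fst ` set (drop (length (tr t)) (tr (Suc t)))"
      using S by (simp add: Qs_def)
    then have "S \<in> fst ` set (transcript D V f0 us (b (Suc t)))"
      using set_drop_subset[of "length (tr t)" "tr (Suc t)"] unfolding tr_def by blast
    then obtain y where "(S, y) \<in> set (transcript D V f0 us (b (Suc t)))"
      by force
    then have "S \<subseteq> appeared us (b (Suc t))"
      using feasible inst0 \<tau>_le[OF t] unfolding feasible_algorithm_def by fastforce
    then show ?thesis
      using appeared_b[OF t] by blast
  qed
  have finite_reached: "finite (reached t)" for t
  proof -
    have "reached t = (\<Union>r\<le>K. \<Union>a\<le>t div d ^ r. node r a)"
      by (auto simp: reached_def)
    then show ?thesis
      by (simp add: finite_node)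
  qed

  define hit where "hit t' S r = {(t, h) \<in> {..<d ^ K} \<times> {..<m * d ^ K}. t div d ^ r = t' div d ^ r \<and>
      S \<inter> special t h (Suc r) (t div d ^ Suc r) \<noteq> {}}" for t' S r
  \<comment> \<open>Queries of at least \<open>T\<close> elements have value 1 under both functions
    and reveal nothing.\<close>
  define small where "small t = {S \<in> Qs t. card S < T}" for t
  define Z where "Z = (\<Union>t<d ^ K. \<Union>S\<in>small t. \<Union>r<K. hit t S r)"
  have finite_small: "finite (small t)" for t
    by (simp add: small_def Qs_def)
  have card_Z: "card Z \<le> K * T * d ^ (K - 1) * (length (tr (d ^ K)) + d ^ K)"
  proof -
    have "card Z \<le> (\<Sum>t<d ^ K. \<Sum>S\<in>small t. \<Sum>r<K. card (hit t S r))"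
      unfolding Z_def
      by (intro order_trans[OF card_UN_le] sum_mono order_refl finite_small finite_lessThan)
    also have "\<dots> \<le> (\<Sum>t<d ^ K. \<Sum>S\<in>small t. \<Sum>r<K. T * d ^ (K - 1))"
      using finite_subset[OF Qs_reached finite_reached] unfolding hit_def
      by (intro sum_mono card_hit_le) (auto simp: small_def)
    also have "\<dots> = K * T * d ^ (K - 1) * (\<Sum>t<d ^ K. card (small t))"
      by (simp add: sum_distrib_left algebra_simps)
    also have "(\<Sum>t<d ^ K. card (small t)) \<le> (\<Sum>t<d ^ K. card (Qs t))"
      by (intro sum_mono card_mono) (auto simp: small_def Qs_def)
    also have "\<dots> \<le> length (tr (d ^ K)) + d ^ K"
      by (rule card_Qs)
    finally show ?thesis by simp
  qed

  have fails: "(t, h) \<in> Z" if j: "(t, h) \<in> J" and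
    success: "\<forall>i\<in>{1..length us}. \<gamma> * OPT (f (t, h)) k (active us i) \<le> f (t, h) (solution D V (f (t, h)) us i)" for t h
  proof (rule ccontr)
    assume nZ: "(t, h) \<notin> Z"
    have t: "t < d ^ K"
      using j by (simp add: J_def)
    have eq: "f (t, h) S = f0 S" if t': "t' \<le> t" and S: "S \<in> Qs t'" for t' S
    proof (cases "card S < T")
      case True
      have t'K: "t' < d ^ K"
        using t t' by simp
      \<comment> \<open>Either both segments lie below the same node of height \<open>r\<close>, and
        \<open>nZ\<close> excludes a hit, or the traversal has not yet entered the node above
        \<open>t\<close> when \<open>S\<close> is asked.\<close>
      have "S \<inter> special t h (Suc r) (t div d ^ Suc r) = {} \<or> avoids r (t div d ^ r) S" if "r < K" for r
      proof (cases "t div d ^ r = t' div d ^ r")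
        case eq: True
        have "(t, h) \<notin> hit t' S r"
          using nZ that t'K S True by (auto simp: Z_def small_def)
        then show ?thesis
          using eq j by (auto simp: hit_def J_def)
      next
        case False
        then have "t' div d ^ r < t div d ^ r"
          using div_le_mono[OF t', of "d ^ r"] by linarith
        then show ?thesis
          using reached_avoids[OF Qs_reached[OF t'K S]] by blast
      qed
      then have "hidden t h K 0 S = blank K 0 S"
        by (intro hidden_eq_blank) auto
      then show ?thesis
        by (simp add: f_def f0_def covered_def)
    next
      case False
      then show ?thesis
        using T covered_large[OF residual_blank blank1] covered_large[OF residual_hidden hidden1]
        by (simp add: f_def f0_def)
    qed
    have "f (t, h) S = f0 S" if "(S, y) \<in> set (transcript D V f0 us (\<tau> t))" for S y
    proof -
      have "S \<in> fst ` set (tr (Suc t))"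
        using that transcript_prefix[OF \<tau>_le(2)[OF t], of D V f0 us] by (force simp: tr_def)
      then show ?thesis
        using tr_queries[of "Suc t"] eq by (auto simp: less_Suc_eq_le)
    qed
    then have sol: "solution D V (f (t, h)) us (\<tau> t) = solution D V f0 us (\<tau> t)"
      by (intro solution_cong \<tau>_le(1)[OF t])
    let ?O = "solution D V f0 us (\<tau> t)"
    have "?O \<subseteq> active us (\<tau> t)" "card ?O \<le> k"
      using feasible inst0 \<tau>_le[OF t] unfolding feasible_algorithm_def by fastforce+
    then have "f0 ?O < \<gamma> * (1 - \<eta> ^ Suc K)"
      using hard[OF t] active_\<tau>[OF t] by (simp add: f0_def)
    moreover have "f (t, h) ?O = f0 ?O"
      by (rule eq[of t]) (auto simp: Qs_def)
    moreover have "1 - \<eta> ^ Suc K \<le> OPT (f (t, h)) k (active us (\<tau> t))"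
    proof -
      let ?S = "\<Union>r\<le>K. special t h r (t div d ^ r)"
      have "?S \<subseteq> path t" "card ?S \<le> k" "hidden t h K 0 ?S = \<eta> ^ Suc K"
        using hidden_special_path[OF t, of h] \<beta> by auto
      moreover have "1 - \<eta> ^ Suc K \<le> f (t, h) ?S"
        using \<eta> calculation(3) by (simp add: f_def covered_def)
      moreover have "finite (path t)"
        by (simp add: path_def finite_node)
      ultimately show ?thesis
        unfolding active_\<tau>[OF t] by (meson OPT_ge order_trans)
    qed
    then have "\<gamma> * (1 - \<eta> ^ Suc K) \<le> \<gamma> * OPT (f (t, h)) k (active us (\<tau> t))"
      using \<gamma> by (rule mult_left_mono)
    moreover have "\<gamma> * OPT (f (t, h)) k (active us (\<tau> t)) \<le> f (t, h) (solution D V (f (t, h)) us (\<tau> t))"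
      using success \<tau>_le[OF t] by simp
    ultimately show False
      using sol by simp
  qed
  have "finite Z"
    by (rule finite_subset[OF _ J(1)]) (auto simp: Z_def hit_def J_def)
  then have "card {j \<in> J. \<forall>i\<in>{1..length us}.
        \<gamma> * OPT (f j) k (active us i) \<le> f j (solution D V (f j) us i)} \<le> card Z"
    using fails by (intro card_mono) auto
  then have "2 * card J \<le> 3 * card Z"
    using D(2) by linarith
  then have "2 * (d ^ K * (6 * K * T * d ^ K)) \<le> 3 * (K * T * d ^ (K - 1) * (length (tr (d ^ K)) + d ^ K))"
    using card_Z unfolding J(3) m by linarith
  \<comment> \<open>The choice \<open>m = 6 * K * T\<close> leaves \<open>4 * d ^ Suc K\<close>
    after cancellation, enough to absorb the \<open>d ^ K\<close> outputs counted as
    queries.\<close>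
  moreover have "2 * (d ^ K * (6 * K * T * d ^ K)) = (3 * K * T * d ^ (K - 1)) * (4 * d ^ Suc K)"
  proof -
    have "2 * (d ^ K * (6 * K * T * d ^ K)) = 12 * K * T * (d ^ K * d ^ K)"
      by (simp add: mult_ac)
    also have "d ^ K * d ^ K = d ^ (K - 1) * d ^ Suc K"
      using K by (simp del: power_Suc flip: power_add)
    finally show ?thesis
      by (simp add: mult_ac)
  qed
  ultimately have "(3 * K * T * d ^ (K - 1)) * (4 * d ^ Suc K) \<le> (3 * K * T * d ^ (K - 1)) * (length (tr (d ^ K)) + d ^ K)"
    by (simp only: mult.assoc)
  then have "4 * d ^ Suc K \<le> length (tr (d ^ K)) + d ^ K"
    using K T d_pos by (subst (asm) mult_le_cancel1) auto
  moreover have "d ^ K \<le> d ^ Suc K"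
    using d_pos by simp
  ultimately have "d ^ Suc K \<le> length (tr (d ^ K))"
    by linarith
  also have "b (d ^ K) \<le> length us"
    by (simp add: b_def us_def)
  then have "length (tr (d ^ K)) \<le> total_queries D V f0 us"
    using transcript_prefix[of "b (d ^ K)" "length us" D V f0 us] by (auto simp: tr_def total_queries_def)
  finally have "real (d ^ Suc K) \<le> real (total_queries D V f0 us)"
    by (simp only: of_nat_le_iff)
  also have "\<dots> \<le> real n * Q n"
    using M(3) D(1) inst0 len unfolding amortized_query_complexity_def by metis
  finally show ?thesis .
qed

end

section \<open>The value of the blank solutions\<close>

text \<open>\<open>level_weight \<eta> r\<close> is the uncovered part at height \<open>r\<close> when \<open>S\<close> contains \<open>\<beta> i\<close> ordinary
  elements of every node of height \<open>i \<le> r\<close> on the path. Up to rounding this is the best choice of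
  \<open>S\<close>, because the sizes \<open>\<beta> i\<close> are proportional to the derivatives \<open>slope \<eta> K i\<close> there.\<close>

primrec level_weight :: "real \<Rightarrow> nat \<Rightarrow> real" where
  "level_weight \<eta> 0 = \<eta>"
| "level_weight \<eta> (Suc r) = \<eta> * (1 - \<eta> + \<eta> * level_weight \<eta> r)"

definition slope :: "real \<Rightarrow> nat \<Rightarrow> nat \<Rightarrow> real" where
  "slope \<eta> K i = \<eta> ^ (2 * (K - i)) * level_weight \<eta> i"

text \<open>\<open>\<eta> / (1 + \<eta>)\<close> is the fixed point of the increasing recursion,
  which starts above it. It tends to \<open>1 / 2\<close> as \<open>\<eta>\<close> tends to
  1.\<close>

lemma level_weight_bounds:
  assumes "0 < \<eta>" "\<eta> < 1"
  shows "\<eta> / (1 + \<eta>) \<le> level_weight \<eta> r" "level_weight \<eta> r \<le> 1"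
proof -
  show "\<eta> / (1 + \<eta>) \<le> level_weight \<eta> r"
  proof (induction r)
    case 0
    show ?case
      using assms by (simp add: divide_le_eq)
  next
    case (Suc r)
    have "\<eta> / (1 + \<eta>) = \<eta> * (1 - \<eta> + \<eta> * (\<eta> / (1 + \<eta>)))"
      using assms by (simp add: field_simps)
    also have "\<dots> \<le> level_weight \<eta> (Suc r)"
      unfolding level_weight.simps using Suc assms by (intro mult_left_mono add_left_mono) auto
    finally show ?case .
  qed
  show "level_weight \<eta> r \<le> 1"
  proof (induction r)
    case (Suc r)
    have "1 - \<eta> + \<eta> * level_weight \<eta> r \<le> 1 - \<eta> + \<eta> * 1"
      using Suc assms by (intro add_left_mono mult_left_mono) auto
    then have "level_weight \<eta> (Suc r) \<le> \<eta> * 1"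
      unfolding level_weight.simps using assms by (intro mult_left_mono) auto
    then show ?case
      using assms by linarith
  qed (use assms in simp)
qed

lemma slope_bounds:
  assumes "0 < \<eta>" "\<eta> < 1"
  shows "0 < slope \<eta> K i" "slope \<eta> K i \<le> 1"
proof -
  have "0 < \<eta> / (1 + \<eta>)"
    using assms by simp
  then have w: "0 < level_weight \<eta> i" "level_weight \<eta> i \<le> 1"
    using level_weight_bounds[OF assms, of i] by linarith+
  then show "0 < slope \<eta> K i"
    using assms by (simp add: slope_def)
  show "slope \<eta> K i \<le> 1"
    using w assms by (auto simp: slope_def power_le_one intro!: mult_le_one)
qed

lemma powr_ge_tangent: "0 < \<eta> \<Longrightarrow> 1 + ln \<eta> * v \<le> \<eta> powr v" for \<eta> v :: real
  using exp_ge_add_one_self[of "v * ln \<eta>"] by (simp add: powr_def mult.commute)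

context hard_tree begin

lemma q_pow_eq_powr: "q r ^ x = \<eta> powr (real x / real (\<beta> r))"
proof -
  have "q r = \<eta> powr (1 / real (\<beta> r))"
    using \<eta> \<beta>_pos[of r] by (simp add: q_def root_powr_inverse)
  then show ?thesis
    using \<eta> by (simp add: powr_powr flip: powr_realpow)
qed

text \<open>The left side is the tangent at \<open>u = 0\<close> and all \<open>z i = 1\<close>. The
  extra factor \<open>\<eta> powr u\<close> carries what the levels above contribute through the
  induction.\<close>

lemma blank_tangent:
  assumes S: "S \<subseteq> path t"
  defines "z i \<equiv> real (card (S \<inter> node i (t div d ^ i))) / real (\<beta> i)"
  shows "r \<le> K \<Longrightarrow> level_weight \<eta> r * (1 + ln \<eta> * u) - ln \<eta> * (\<Sum>i\<le>r. slope \<eta> r i * (1 - z i))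
    \<le> \<eta> powr u * blank r (t div d ^ r) S"
proof (induction r arbitrary: u)
  case 0
  have "\<eta> powr u * blank 0 (t div d ^ 0) S = \<eta> * \<eta> powr (u + z 0 - 1)"
    using \<eta> by (simp add: q_pow_eq_powr z_def powr_add powr_diff)
  moreover have "\<eta> * (1 + ln \<eta> * (u + z 0 - 1)) \<le> \<eta> * \<eta> powr (u + z 0 - 1)"
    using \<eta> by (intro mult_left_mono powr_ge_tangent) auto
  ultimately show ?case
    by (simp add: slope_def algebra_simps)
next
  case (Suc r)
  \<comment> \<open>One factor \<open>\<eta>\<close> is split off for a full block; the remaining
    exponent is handed to the child as its new \<open>u\<close>.\<close>
  define v where "v = u + z (Suc r) - 1"
  define b where "b = blank r (t div d ^ r) S"
  define Z where "Z = (\<Sum>i\<le>r. slope \<eta> r i * (1 - z i))"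
  have slope_Suc: "slope \<eta> (Suc r) i = \<eta>\<^sup>2 * slope \<eta> r i" if "i \<le> r" for i
    using that by (simp add: slope_def Suc_diff_le power_add power2_eq_square)
  have sum_Suc: "(\<Sum>i\<le>Suc r. slope \<eta> (Suc r) i * (1 - z i)) =
      \<eta>\<^sup>2 * Z + level_weight \<eta> (Suc r) * (1 - z (Suc r))"
    by (simp add: Z_def sum_distrib_left slope_Suc mult.assoc) (simp add: slope_def)
  have "level_weight \<eta> (Suc r) * (1 + ln \<eta> * u) - ln \<eta> * (\<Sum>i\<le>Suc r. slope \<eta> (Suc r) i * (1 - z i)) =
      \<eta> * ((1 - \<eta>) * (1 + ln \<eta> * v) + \<eta> * (level_weight \<eta> r * (1 + ln \<eta> * v) - ln \<eta> * Z))"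
    unfolding sum_Suc v_def level_weight.simps by (simp add: algebra_simps power2_eq_square)
  also have "\<dots> \<le> \<eta> * ((1 - \<eta>) * \<eta> powr v + \<eta> * (\<eta> powr v * b))"
    using Suc \<eta> unfolding b_def Z_def
    by (intro mult_left_mono add_mono powr_ge_tangent) auto
  also have "\<dots> = (\<eta> * \<eta> powr v) * (1 - \<eta> + \<eta> * b)"
    by (simp add: algebra_simps)
  also have "\<eta> * \<eta> powr v = \<eta> powr u * q (Suc r) ^ card (S \<inter> node (Suc r) (t div d ^ Suc r))"
    using \<eta> by (simp add: v_def z_def q_pow_eq_powr powr_add powr_diff)
  also have "\<dots> * (1 - \<eta> + \<eta> * b) = \<eta> powr u * blank (Suc r) (t div d ^ Suc r) S"
    using Suc.prems unfolding b_def by (subst blank_path_Suc[OF S]) auto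
  finally show ?case .
qed

text \<open>By the hypothesis on the block sizes, each element lowers the tangent by at most
  \<open>- ln \<eta> * c / l\<close>. So \<open>k\<close> elements gain over the full blocks only
  what the \<open>Suc K\<close> elements reserved for rounding allow.\<close>

lemma blank_ge:
  assumes t: "t < d ^ K" and S: "S \<subseteq> path t" "card S \<le> k" and k: "Suc K < k"
    and \<beta>: "\<And>i. i \<le> K \<Longrightarrow> real (k - Suc K) * slope \<eta> K i \<le> real (\<beta> i) * (\<Sum>i\<le>K. slope \<eta> K i)"
  shows "\<eta> / (1 + \<eta>) + ln \<eta> * (real (Suc K))\<^sup>2 / real (k - Suc K) \<le> blank K 0 S"
proof -
  define c where "c = (\<Sum>i\<le>K. slope \<eta> K i)"
  define x where "x i = card (S \<inter> node i (t div d ^ i))" for i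
  define l where "l = real (k - Suc K)"
  have l: "0 < l" "real k = l + real (Suc K)"
    using k by (auto simp: l_def)
  have c: "0 \<le> c" "c \<le> real (Suc K)"
  proof -
    show "0 \<le> c"
      unfolding c_def using slope_bounds[OF \<eta>] by (intro sum_nonneg less_imp_le)
    have "c \<le> (\<Sum>i\<le>K. 1)"
      unfolding c_def using slope_bounds[OF \<eta>] by (intro sum_mono)
    then show "c \<le> real (Suc K)"
      by simp
  qed
  have finS: "finite S"
    using S(1) by (rule finite_subset) (simp add: path_def finite_node)
  have "(\<Sum>i\<le>K. x i) = card (\<Union>i\<le>K. S \<inter> node i (t div d ^ i))"
    unfolding x_def using finS by (subst card_UN_disjoint) (auto dest: node_unique)
  also have "\<dots> \<le> card S"
    using finS by (intro card_mono) auto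
  finally have x: "(\<Sum>i\<le>K. real (x i)) \<le> real k"
    using S(2) by (simp flip: of_nat_sum)
  have "slope \<eta> K i * (real (x i) / real (\<beta> i)) \<le> real (x i) * (c / l)" if "i \<le> K" for i
  proof -
    have "l * slope \<eta> K i \<le> real (\<beta> i) * c"
      using \<beta>[OF that] unfolding c_def l_def .
    then have "slope \<eta> K i / real (\<beta> i) \<le> c / l"
      using \<beta>_pos[of i] l(1) by (simp add: field_simps)
    then show ?thesis
      using mult_left_mono[of "slope \<eta> K i / real (\<beta> i)" "c / l" "real (x i)"] by (simp add: mult.commute)
  qed
  then have "(\<Sum>i\<le>K. slope \<eta> K i * (real (x i) / real (\<beta> i))) \<le> (\<Sum>i\<le>K. real (x i) * (c / l))"
    by (intro sum_mono) auto
  also have "\<dots> = (\<Sum>i\<le>K. real (x i)) * (c / l)"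
    by (simp only: sum_distrib_right)
  also have "\<dots> \<le> real k * (c / l)"
    using x c l by (intro mult_right_mono) auto
  also have "\<dots> = c + c * real (Suc K) / l"
    using l by (simp add: field_simps)
  also have "c * real (Suc K) / l \<le> (real (Suc K))\<^sup>2 / l"
    unfolding power2_eq_square using c l by (intro divide_right_mono mult_right_mono) auto
  finally have "- ((real (Suc K))\<^sup>2 / l) \<le> (\<Sum>i\<le>K. slope \<eta> K i * (1 - real (x i) / real (\<beta> i)))"
    by (simp add: c_def right_diff_distrib sum_subtractf)
  then have "- ln \<eta> * - ((real (Suc K))\<^sup>2 / l) \<le> - ln \<eta> * (\<Sum>i\<le>K. slope \<eta> K i * (1 - real (x i) / real (\<beta> i)))"
    using \<eta> by (intro mult_left_mono) auto
  moreover have "level_weight \<eta> K - ln \<eta> * (\<Sum>i\<le>K. slope \<eta> K i * (1 - real (x i) / real (\<beta> i))) \<le> blank K 0 S"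
    using blank_tangent[OF S(1), of K 0] t \<eta> by (simp add: x_def)
  ultimately show ?thesis
    using level_weight_bounds(1)[OF \<eta>, of K] by (simp add: l_def)
qed

end

section \<open>Choice of the parameters\<close>

lemma power_exp_bound:
  fixes \<epsilon> :: real
  assumes "0 < \<epsilon>" "\<epsilon> \<le> 1 / 2" "4 / \<epsilon> * ln (8 / \<epsilon>) \<le> real K"
  shows "(1 - \<epsilon> / 4) ^ K \<le> \<epsilon> / 8"
proof -
  have "1 - \<epsilon> / 4 \<le> exp (- (\<epsilon> / 4))"
    using exp_ge_add_one_self[of "- (\<epsilon> / 4)"] by simp
  then have "(1 - \<epsilon> / 4) ^ K \<le> exp (- (\<epsilon> / 4)) ^ K"
    using assms by (intro power_mono) auto
  also have "\<dots> = exp (- (\<epsilon> / 4 * real K))"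
    by (simp flip: exp_of_nat_mult add: mult.commute)
  also have "\<dots> \<le> exp (- ln (8 / \<epsilon>))"
    using assms by (simp add: field_simps)
  also have "\<dots> = \<epsilon> / 8"
    using assms by (simp add: exp_minus)
  finally show ?thesis .
qed

lemma tree_query_bound:
  fixes \<epsilon> \<gamma> :: real and k K N d n :: nat
  assumes \<epsilon>: "0 < \<epsilon>" "\<epsilon> \<le> 1 / 2" "1 / 2 + \<epsilon> \<le> \<gamma>"
    and K: "1 \<le> K" "4 / \<epsilon> * ln (8 / \<epsilon>) \<le> real K" and N: "16 / \<epsilon> \<le> real N"
    and k: "real (Suc K) + 8 * (real (Suc K))\<^sup>2 / \<epsilon> \<le> real k"
    and d: "1 \<le> d" and n: "12 * K * N * k\<^sup>2 * d ^ K \<le> n"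
    and M: "randomized_algorithm k M" "achieves_ratio k M \<gamma>" "amortized_query_complexity M Q"
  shows "real (d ^ Suc K) \<le> real n * Q n"
proof -
  define \<eta> where "\<eta> = 1 - \<epsilon> / 4"
  have \<eta>: "0 < \<eta>" "\<eta> < 1"
    using \<epsilon> by (auto simp: \<eta>_def)
  define c where "c = (\<Sum>i\<le>K. slope \<eta> K i)"
  have c: "0 < c"
    unfolding c_def using slope_bounds(1)[OF \<eta>] by (intro sum_pos) auto
  have "0 < 8 * (real (Suc K))\<^sup>2 / \<epsilon>"
    using \<epsilon> by simp
  then have kK: "Suc K < k"
    using k by linarith
  define l where "l = real (k - Suc K)"
  have l: "0 < l" "8 * (real (Suc K))\<^sup>2 / \<epsilon> \<le> l"
    using k kK by (auto simp: l_def of_nat_diff)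
  \<comment> \<open>Rounding up adds less than 1 at each of \<open>Suc K\<close> heights, which is
    why \<open>l\<close> falls short of \<open>k\<close> by \<open>Suc K\<close>.\<close>
  define \<beta> where "\<beta> i = nat \<lceil>l * slope \<eta> K i / c\<rceil>" for i
  have \<beta>_pos: "1 \<le> \<beta> i" for i
  proof -
    have "0 < l * slope \<eta> K i / c"
      using c l slope_bounds(1)[OF \<eta>, of K i] by simp
    then show ?thesis
      unfolding \<beta>_def by linarith
  qed
  have \<beta>_ge: "l * slope \<eta> K i \<le> real (\<beta> i) * c" for i
    using c by (simp add: \<beta>_def flip: pos_divide_le_eq) (linarith)
  have "real (\<beta> i) \<le> l * slope \<eta> K i / c + 1" for i
    using c l slope_bounds(1)[OF \<eta>, of K i] by (simp add: \<beta>_def)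
  then have "(\<Sum>i\<le>K. real (\<beta> i)) \<le> (\<Sum>i\<le>K. l * slope \<eta> K i / c + 1)"
    by (intro sum_mono)
  also have "\<dots> = l * c / c + real (Suc K)"
    by (simp add: sum.distrib c_def flip: sum_distrib_left sum_divide_distrib)
  also have "\<dots> = real k"
    using c kK by (simp add: l_def of_nat_diff)
  finally have \<beta>_sum: "(\<Sum>i\<le>K. \<beta> i) \<le> k"
    by (simp flip: of_nat_sum)
  \<comment> \<open>This makes the linear term of \<open>covered\<close> at most
    \<open>\<epsilon> / 16\<close> on sets of \<open>k\<close> elements.\<close>
  define T where "T = N * k"
  have "0 < 16 / \<epsilon>"
    using \<epsilon> by simp
  then have N1: "1 \<le> N"
    using N by linarith
  then have T: "1 \<le> T"
    using kK by (simp add: T_def)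
  interpret hard_tree d "6 * K * T" K \<beta> \<eta>
    using d K(1) T \<beta>_pos \<eta> by unfold_locales auto
  have "- ln \<eta> \<le> 1"
  proof -
    have "ln (1 / \<eta>) \<le> 1 / \<eta> - 1"
      using \<eta> by (intro ln_le_minus_one) simp
    also have "\<dots> \<le> 1"
      using \<epsilon> by (simp add: \<eta>_def field_simps)
    finally show ?thesis
      using \<eta> by (simp add: ln_div)
  qed
  have hard: "covered T (blank K 0) S < \<gamma> * (1 - \<eta> ^ Suc K)"
    if "t < d ^ K" "S \<subseteq> path t" "card S \<le> k" for t S
  proof -
    have "\<eta> / (1 + \<eta>) + ln \<eta> * (real (Suc K))\<^sup>2 / l \<le> blank K 0 S"
      unfolding l_def using \<beta>_ge by (intro blank_ge[OF that kK]) (simp add: l_def c_def)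
    moreover have "- ln \<eta> * ((real (Suc K))\<^sup>2 / l) \<le> 1 * (\<epsilon> / 8)"
      using \<open>- ln \<eta> \<le> 1\<close> l \<epsilon> by (intro mult_mono) (auto simp: field_simps)
    moreover have "1 - \<eta> / (1 + \<eta>) \<le> 1 / 2 + \<epsilon> / 8"
    proof -
      have "\<epsilon> * \<epsilon> \<le> \<epsilon> * 4"
        using \<epsilon> by (intro mult_left_mono) auto
      then show ?thesis
        using \<epsilon> by (simp add: \<eta>_def field_simps)
    qed
    moreover have "real (card S) / real T \<le> \<epsilon> / 16"
    proof -
      have "real (card S) / real T \<le> real k / (real N * real k)"
        unfolding T_def of_nat_mult using that(3) by (intro divide_right_mono) auto
      also have "\<dots> = 1 / real N"
        using kK by simp
      also have "\<dots> \<le> \<epsilon> / 16"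
        using N N1 \<epsilon> by (simp add: field_simps)
      finally show ?thesis .
    qed
    moreover have "covered T (blank K 0) S \<le> 1 - blank K 0 S + real (card S) / real T"
      by (simp add: covered_def)
    \<comment> \<open>The errors are \<open>\<epsilon> / 8\<close> from the fixed point,
      \<open>\<epsilon> / 8\<close> from rounding and \<open>\<epsilon> / 16\<close> from the linear
      term.\<close>
    ultimately have "covered T (blank K 0) S \<le> 1 / 2 + 5 * \<epsilon> / 16"
      unfolding times_divide_eq_right[symmetric] by linarith
    also have "\<dots> < (1 / 2 + \<epsilon>) * (1 - \<epsilon> / 8)"
    proof -
      have "\<epsilon> * \<epsilon> \<le> \<epsilon> * (1 / 2)"
        using \<epsilon> by (intro mult_left_mono) auto
      then show ?thesis
        using \<epsilon> by (simp add: field_simps)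
    qed
    also have "\<dots> \<le> \<gamma> * (1 - \<eta> ^ Suc K)"
    proof -
      have "\<eta> ^ Suc K \<le> \<eta> ^ K"
        using \<eta> by (simp add: mult_left_le_one_le)
      also have "\<dots> \<le> \<epsilon> / 8"
        unfolding \<eta>_def by (rule power_exp_bound[OF \<epsilon>(1,2) K(2)])
      finally show ?thesis
        using \<epsilon> by (intro mult_mono) auto
    qed
    finally show ?thesis .
  qed
  show ?thesis
  proof (rule query_lower_bound[OF T K(1) refl \<beta>_sum _ _ hard M])
    show "2 * (6 * K * T) * d ^ K * k \<le> n"
      using n by (simp add: T_def power2_eq_square algebra_simps)
    show "0 \<le> \<gamma>"
      using \<epsilon> by simp
  qed
qed

text \<open>Let \<open>f\<close> be the indicator of one hidden element among \<open>4 * k\<close>.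
  Without queries the output is the same for all of them and contains at most a quarter, below the
  required two thirds.\<close>

lemma at_least_one_query:
  assumes k: "1 \<le> k" and n: "4 * k \<le> n" and \<gamma>: "0 < \<gamma>"
    and M: "randomized_algorithm k M" "achieves_ratio k M \<gamma>" "amortized_query_complexity M Q"
  shows "1 \<le> real n * Q n"
proof (rule ccontr)
  assume less: "\<not> 1 \<le> real n * Q n"
  define us where "us = map Insert [0..<4 * k] @ replicate (n - 4 * k) (Delete 0)"
  define V where "V = elem ` set us"
  define f where "f v S = (if v \<in> S then 1 else 0 :: real)" for v :: nat and S
  have len: "length us = n"
    using n by (simp add: us_def)
  have inst: "dynamic_instance V (f v) us" for v
    by (auto simp: dynamic_instance_def V_def f_def nonneg_on_def monotone_set_fun_def submodular_def)
  obtain D where D: "D \<in> space M"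
    "2 / 3 * real (card {..<4 * k}) \<le> real (card {v \<in> {..<4 * k}. \<forall>i\<in>{1..length us}.
        \<gamma> * OPT (f v) k (active us i) \<le> f v (solution D V (f v) us i)})"
    by (rule sample_algorithm[where J = "{..<4 * k}" and V = "\<lambda>_. V" and f = f and us = "\<lambda>_. us",
          OF M(1,2) _ _ inst]) (use k in \<open>auto simp: lessThan_empty_iff bot_nat_def\<close>)
  have "real (total_queries D V (f v) us) < 1" for v
    using M(3) D(1) inst[of v] len less unfolding amortized_query_complexity_def by fastforce
  then have "transcript D V (f v) us n = []" for v
    by (simp add: total_queries_def len)
  then have no_query: "transcript D V (f v) us (4 * k) = []" for v
    using transcript_prefix[OF n, of D V "f v" us] by auto
  let ?O = "solution D V (f 0) us (4 * k)"
  have O: "solution D V (f v) us (4 * k) = ?O" for v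
    by (rule solution_cong) (use k no_query in auto)
  have active: "active us (4 * k) = {..<4 * k}"
    by (auto simp: active_def us_def foldl_Insert)
  have "card ?O \<le> k" "?O \<subseteq> {..<4 * k}"
    using M(1) D(1) inst[of 0] k n unfolding randomized_algorithm_def feasible_algorithm_def len active[symmetric]
    by (fastforce simp: len)+
  have "v \<in> ?O" if v: "v < 4 * k"
    and success: "\<forall>i\<in>{1..length us}. \<gamma> * OPT (f v) k (active us i) \<le> f v (solution D V (f v) us i)" for v
  proof -
    have "1 \<le> OPT (f v) k {..<4 * k}"
      using OPT_ge[of "{..<4 * k}" "{v}" k "f v"] v k by (simp add: f_def)
    then have "0 < \<gamma> * OPT (f v) k (active us (4 * k))"
      using \<gamma> by (simp add: active)
    also have "\<dots> \<le> f v ?O"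
      using bspec[OF success, of "4 * k"] k n unfolding len O[of v] by simp
    finally show ?thesis
      by (simp add: f_def split: if_splits)
  qed
  then have "card {v \<in> {..<4 * k}. \<forall>i\<in>{1..length us}.
        \<gamma> * OPT (f v) k (active us i) \<le> f v (solution D V (f v) us i)} \<le> card ?O"
    using \<open>?O \<subseteq> _\<close> by (intro card_mono) (auto intro: finite_subset)
  then show False
    using D(2) \<open>card ?O \<le> k\<close> k by simp
qed

section \<open>The exponent\<close>

definition height :: "real \<Rightarrow> nat" where
  "height \<epsilon> = nat \<lceil>4 / \<epsilon> * ln (8 / \<epsilon>)\<rceil>"

text \<open>Capping at \<open>1 / 2\<close> keeps the exponent positive: for large \<epsilon> the
  logarithm in \<open>height\<close> is negative and the height would be 0.\<close>

definition exponent :: "real \<Rightarrow> real" where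
  "exponent \<epsilon> = 1 / (2 * real (height (min \<epsilon> (1 / 2))))"

lemma height_ge: "4 / \<epsilon> * ln (8 / \<epsilon>) \<le> real (height \<epsilon>)"
  unfolding height_def by linarith

lemma height_ge_4:
  assumes "0 < \<epsilon>" "\<epsilon> \<le> 1 / 2"
  shows "4 \<le> height \<epsilon>"
proof -
  have "3 \<le> 8 / \<epsilon>"
    using assms by (simp add: field_simps)
  then have "exp 1 \<le> 8 / \<epsilon>"
    using exp_le by linarith
  then have "1 \<le> ln (8 / \<epsilon>)"
    using assms by (simp add: ln_ge_iff)
  moreover have "4 \<le> 4 / \<epsilon>"
    using assms by (simp add: field_simps)
  ultimately have "4 * 1 \<le> 4 / \<epsilon> * ln (8 / \<epsilon>)"
    using assms by (intro mult_mono) auto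
  then show ?thesis
    using height_ge[of \<epsilon>] by linarith
qed

lemma exponent_pos:
  assumes "0 < \<epsilon>"
  shows "0 < exponent \<epsilon>"
proof -
  have "4 \<le> height (min \<epsilon> (1 / 2))"
    using assms by (intro height_ge_4 min.cobounded2) simp
  then show ?thesis
    by (simp add: exponent_def)
qed

lemma exponent_soft_Omega: "exponent \<in> soft_Omega (\<lambda>\<epsilon>. \<epsilon>)"
proof -
  have bound: "1 / 18 * norm (\<epsilon> / ln (1 / \<epsilon>) ^ 1) \<le> norm (exponent \<epsilon>)" if \<epsilon>: "0 < \<epsilon>" "\<epsilon> < 1 / 8" for \<epsilon>
  proof -
    define L where "L = ln (1 / \<epsilon>)"
    have "3 \<le> 1 / \<epsilon>"
      using \<epsilon> by (simp add: field_simps)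
    then have "exp 1 \<le> 1 / \<epsilon>"
      using exp_le by linarith
    then have L: "1 \<le> L"
      using \<epsilon> by (simp add: L_def ln_ge_iff)
    \<comment> \<open>Here \<open>\<epsilon> < 1 / 8\<close> gives
      \<open>8 \<le> 1 / \<epsilon>\<close>, so a single power of the logarithm suffices.\<close>
    have "ln (8 / \<epsilon>) \<le> ln ((1 / \<epsilon>) * (1 / \<epsilon>))"
      using \<epsilon> by (subst ln_le_cancel_iff) (auto simp: field_simps)
    also have "\<dots> = 2 * L"
      using \<epsilon> by (subst ln_mult) (auto simp: L_def)
    finally have "4 / \<epsilon> * ln (8 / \<epsilon>) \<le> 4 / \<epsilon> * (2 * L)"
      using \<epsilon> by (intro mult_left_mono) auto
    moreover have "0 \<le> 4 / \<epsilon> * ln (8 / \<epsilon>)"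
      using \<epsilon> by (intro mult_nonneg_nonneg) auto
    then have "real (height \<epsilon>) \<le> 4 / \<epsilon> * ln (8 / \<epsilon>) + 1"
      unfolding height_def by linarith
    moreover have "1 \<le> L / \<epsilon>"
      using L \<epsilon> by (simp add: field_simps)
    moreover have "4 / \<epsilon> * (2 * L) = 8 * (L / \<epsilon>)"
      by simp
    ultimately have "real (height \<epsilon>) \<le> 9 * (L / \<epsilon>)"
      by linarith
    moreover have "0 < real (height \<epsilon>)"
      using height_ge_4[of \<epsilon>] \<epsilon> by simp
    ultimately have "1 / (18 * (L / \<epsilon>)) \<le> 1 / (2 * real (height \<epsilon>))"
      using L \<epsilon> by (intro divide_left_mono) auto
    then show ?thesis
      using \<epsilon> L by (simp add: exponent_def min_def flip: L_def)
  qed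
  have "exponent \<in> \<Omega>[at_right 0](\<lambda>\<epsilon>. \<epsilon> / ln (1 / \<epsilon>) ^ 1)"
  proof (rule landau_omega.bigI)
    show "0 < 1 / (18 :: real)"
      by simp
    show "\<forall>\<^sub>F \<epsilon> in at_right 0. 1 / 18 * norm (\<epsilon> / ln (1 / \<epsilon>) ^ 1) \<le> norm (exponent \<epsilon>)"
      by (rule eventually_mono[OF eventually_at_right_real[of 0 "1 / 8"]]) (use bound in auto)
  qed
  then show ?thesis
    unfolding soft_Omega_def by blast
qed

text \<open>For \<open>n < A * k\<^sup>2\<close> the tree does not fit into the stream, but the claimed bound is so
  small that a single query suffices.\<close>

lemma query_complexity_bound:
  fixes \<epsilon> \<gamma> :: real
  assumes \<epsilon>: "0 < \<epsilon>" "\<epsilon> \<le> 1 / 2"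
  defines "K \<equiv> height \<epsilon>"
  shows "\<exists>C>0. \<forall>k::nat. real k \<ge> C \<longrightarrow> (\<forall>M Q \<gamma>. 1 / 2 + \<epsilon> \<le> \<gamma> \<and> randomized_algorithm k M \<and>
      achieves_ratio k M \<gamma> \<and> amortized_query_complexity M Q \<longrightarrow>
      (\<forall>n::nat. real n \<ge> C * real k \<longrightarrow> real n powr (1 / (2 * real K)) / real k ^ 3 \<le> Q n))"
proof -
  define \<alpha> where "\<alpha> = 1 / (2 * real K)"
  define N where "N = nat \<lceil>16 / \<epsilon>\<rceil>"
  \<comment> \<open>\<open>A * k\<^sup>2 * d ^ K\<close> is the stream length that the tree
    requires. The factor \<open>2 * 2 ^ K\<close> in \<open>B\<close> pays for rounding the arity
    down in \<open>d ^ Suc K\<close>, and each summand of \<open>C\<close> serves one later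
    estimate.\<close>
  define A where "A = real (12 * K * N)"
  define B where "B = 2 * 2 ^ K * A"
  define C where "C = 4 + (A * B)\<^sup>2 + A ^ 4 + (real (Suc K) + 8 * (real (Suc K))\<^sup>2 / \<epsilon>)"
  have K: "4 \<le> K"
    unfolding K_def by (rule height_ge_4[OF \<epsilon>])
  have N: "16 / \<epsilon> \<le> real N" "1 \<le> N"
  proof -
    show "16 / \<epsilon> \<le> real N"
      unfolding N_def by linarith
    moreover have "0 < 16 / \<epsilon>"
      using \<epsilon> by simp
    ultimately show "1 \<le> N"
      by linarith
  qed
  have \<alpha>: "0 < \<alpha>" "\<alpha> \<le> 1 / 8" "1 / real K = 2 * \<alpha>"
    using K by (auto simp: \<alpha>_def field_simps)
  have "1 \<le> 12 * K * N"
    using K N by simp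
  then have A: "1 \<le> A"
    unfolding A_def by linarith
  then have B: "0 < B"
    by (simp add: B_def)
  have "0 \<le> (A * B)\<^sup>2" "0 \<le> A ^ 4" "0 \<le> 8 * (real (Suc K))\<^sup>2 / \<epsilon>"
    using A \<epsilon> by auto
  then have C: "4 \<le> C" "(A * B)\<^sup>2 \<le> C" "A ^ 4 \<le> C" "real (Suc K) + 8 * (real (Suc K))\<^sup>2 / \<epsilon> \<le> C"
    unfolding C_def by linarith+
  have main: "real n powr \<alpha> / real k ^ 3 \<le> Q n"
    if k: "C \<le> real k" and \<gamma>: "1 / 2 + \<epsilon> \<le> \<gamma>" and n: "C * real k \<le> real n"
      and M: "randomized_algorithm k M" "achieves_ratio k M \<gamma>" "amortized_query_complexity M Q"
    for k n M Q \<gamma>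
  proof -
    have k4: "4 \<le> real k"
      using k C by simp
    have "4 * real k \<le> C * real k"
      using C k4 by (intro mult_right_mono) auto
    then have n4: "4 * k \<le> n"
      using n by (simp flip: of_nat_le_iff)
    then have n_pos: "0 < real n"
      using k4 by simp
    have sqrt_k: "sqrt (real k) * sqrt (real k) = real k" "0 < sqrt (real k)"
      using k4 by auto
    show ?thesis
    proof (cases "A * (real k)\<^sup>2 \<le> real n")
      case False
      have "1 \<le> real n * Q n"
        by (rule at_least_one_query[OF _ n4 _ M]) (use k4 \<gamma> \<epsilon> in auto)
      then have "1 / real n \<le> Q n"
        using n_pos by (simp add: field_simps)
      moreover have "1 / (A * (real k)\<^sup>2) \<le> 1 / real n"
        using False n_pos by (intro divide_left_mono) auto
      \<comment> \<open>This amounts to \<open>A * n powr \<alpha> \<le> k\<close>. Since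
        \<open>\<alpha> \<le> 1 / 8\<close>, the power is at most \<open>A * k powr (1 / 4)\<close>,
        and \<open>A\<close> itself is at most \<open>k powr (1 / 4)\<close>.\<close>
      moreover have "real n powr \<alpha> / real k ^ 3 \<le> 1 / (A * (real k)\<^sup>2)"
      proof -
        have "real n powr \<alpha> \<le> (A * (real k)\<^sup>2) powr \<alpha>"
          using False \<alpha> by (intro powr_mono2) auto
        also have "\<dots> = A powr \<alpha> * (real k powr (2 * \<alpha>))"
          using A k4 by (simp add: powr_mult powr_powr flip: powr_numeral)
        also have "\<dots> \<le> A powr 1 * real k powr (1 / 4)"
          using A k4 \<alpha> by (intro mult_mono powr_mono) auto
        finally have 1: "real n powr \<alpha> \<le> A * real k powr (1 / 4)"
          using A by simp
        have "A ^ 4 \<le> real k"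
          using C k by linarith
        then have "(A ^ 4) powr (1 / 4) \<le> real k powr (1 / 4)"
          by (intro powr_mono2) auto
        then have "A \<le> real k powr (1 / 4)"
          using A by (simp add: powr_powr flip: powr_numeral)
        then have "A * real n powr \<alpha> \<le> real k powr (1 / 4) * (real k powr (1 / 4) * real k powr (1 / 4))"
          using 1 A by (intro mult_mono order_trans[OF 1] mult_right_mono) auto
        also have "\<dots> = real k powr (3 / 4)"
          by (simp flip: powr_add)
        also have "\<dots> \<le> real k powr 1"
          using k4 by (intro powr_mono) auto
        finally have "A * real n powr \<alpha> \<le> real k"
          using k4 by simp
        then have "(A * real n powr \<alpha>) * (real k)\<^sup>2 \<le> real k * (real k)\<^sup>2"
          by (intro mult_right_mono) auto
        then show ?thesis
          using A k4 by (simp add: field_simps power2_eq_square power3_eq_cube)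
      qed
      ultimately show ?thesis by linarith
    next
      case True
      \<comment> \<open>The real arity for which the tree fills the stream exactly; \<open>d\<close>
        is its integer part.\<close>
      define y where "y = (real n / (A * (real k)\<^sup>2)) powr (1 / real K)"
      define d where "d = nat \<lfloor>y\<rfloor>"
      have pos: "0 < A * (real k)\<^sup>2"
        using A k4 by simp
      have x1: "1 \<le> real n / (A * (real k)\<^sup>2)"
        using True pos by simp
      then have y1: "1 \<le> y"
        unfolding y_def using \<alpha> by (intro ge_one_powr_ge_zero) auto
      have root_pow: "(x powr (1 / real K)) ^ K = x" if "1 \<le> x" for x
      proof -
        have "(x powr (1 / real K)) ^ K = x powr (real K * (1 / real K))"
          using that by (intro powr_power) simp
        also have "\<dots> = x powr 1"
          using K by simp
        finally show ?thesis
          using that by simp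
      qed
      have y_pow: "y ^ K = real n / (A * (real k)\<^sup>2)"
        unfolding y_def by (rule root_pow[OF x1])
      have d: "1 \<le> d" "real d \<le> y"
        using y1 unfolding d_def by linarith+
      moreover have "y < real d + 1"
        using y1 unfolding d_def by linarith
      ultimately have d2: "y \<le> 2 * real d"
        by linarith
      have "A * (real k)\<^sup>2 * real d ^ K \<le> A * (real k)\<^sup>2 * y ^ K"
        using d pos by (intro mult_left_mono power_mono) auto
      also have "\<dots> = real n"
        using A k4 unfolding y_pow by simp
      finally have "real (12 * K * N * k\<^sup>2 * d ^ K) \<le> real n"
        by (simp add: A_def)
      then have fits: "12 * K * N * k\<^sup>2 * d ^ K \<le> n"
        by (simp only: of_nat_le_iff)
      have "real (d ^ Suc K) \<le> real n * Q n"
        by (rule tree_query_bound[OF \<epsilon> \<gamma> _ _ N(1) _ d(1) fits M])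
          (use K k C height_ge[of \<epsilon>] in \<open>auto simp: K_def\<close>)
      then have Q: "real d * real d ^ K / real n \<le> Q n"
        using n_pos by (simp add: field_simps)
      have "y ^ K \<le> (2 * real d) ^ K"
        using d2 y1 by (intro power_mono) auto
      then have "real n / (A * (real k)\<^sup>2) \<le> 2 ^ K * real d ^ K"
        unfolding y_pow by (simp add: power_mult_distrib)
      then have dK: "1 / (2 ^ K * A * (real k)\<^sup>2) \<le> real d ^ K / real n"
        using n_pos k4 less_le_trans[OF zero_less_one A] by (simp add: field_simps)
      have "y / (B * (real k)\<^sup>2) = (y / 2) * (1 / (2 ^ K * A * (real k)\<^sup>2))"
        by (simp add: B_def)
      also have "\<dots> \<le> real d * (real d ^ K / real n)"
        using d2 dK y1 A by (intro mult_mono) auto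
      finally have Qy: "y / (B * (real k)\<^sup>2) \<le> Q n"
        using Q by simp
      \<comment> \<open>The third factor \<open>k\<close> is split into two square roots: one bounds
        the power of \<open>k\<close> lost in \<open>y\<close>, the other dominates
        \<open>A * B\<close>.\<close>
      have "real n powr \<alpha> / real k ^ 3 \<le> y / (B * (real k)\<^sup>2)"
      proof -
        have "A powr (2 * \<alpha>) \<le> A powr 1" "real k powr (4 * \<alpha>) \<le> real k powr (1 / 2)"
          using \<alpha> A k4 by (intro powr_mono; simp)+
        then have "A powr (2 * \<alpha>) * real k powr (4 * \<alpha>) \<le> A * sqrt (real k)"
          using A k4 by (intro mult_mono) (auto simp: powr_half_sqrt)
        moreover have "(A * (real k)\<^sup>2) powr (2 * \<alpha>) = A powr (2 * \<alpha>) * real k powr (4 * \<alpha>)"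
          using A k4 by (simp add: powr_mult powr_powr flip: powr_numeral)
        ultimately have le: "(A * (real k)\<^sup>2) powr (2 * \<alpha>) \<le> A * sqrt (real k)"
          by simp
        have "y = real n powr (2 * \<alpha>) / (A * (real k)\<^sup>2) powr (2 * \<alpha>)"
          unfolding y_def \<alpha>(3) using pos n_pos by (simp add: powr_divide)
        also have "real n powr (2 * \<alpha>) / (A * sqrt (real k)) \<le> \<dots>"
          using le pos A sqrt_k by (intro divide_left_mono mult_pos_pos) auto
        finally have y: "real n powr (2 * \<alpha>) / (A * sqrt (real k)) \<le> y" .
        have "sqrt ((A * B)\<^sup>2) \<le> sqrt (real k)"
          using C k by (intro real_sqrt_le_mono) linarith
        then have AB: "A * B \<le> sqrt (real k)"
          using A B by (simp add: real_sqrt_abs)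
        have "real n powr \<alpha> \<le> real n powr (2 * \<alpha>)"
          using n4 k4 \<alpha> by (intro powr_mono) auto
        then have "real n powr \<alpha> * (A * B) \<le> real n powr (2 * \<alpha>) * sqrt (real k)"
          using AB A B by (intro mult_mono) auto
        then have "real n powr \<alpha> * (A * B) * sqrt (real k) \<le> real n powr (2 * \<alpha>) * real k"
          using sqrt_k by (metis mult.assoc mult_right_mono less_imp_le)
        then have "real n powr \<alpha> / real k \<le> real n powr (2 * \<alpha>) / (A * sqrt (real k)) / B"
          using A B k4 sqrt_k(2) by (simp add: field_simps)
        also have "\<dots> \<le> y / B"
          using y B by (intro divide_right_mono) auto
        finally have "real n powr \<alpha> / real k / (real k)\<^sup>2 \<le> y / B / (real k)\<^sup>2"
          by (intro divide_right_mono) auto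
        then show ?thesis
          by (simp add: power2_eq_square power3_eq_cube)
      qed
      then show ?thesis
        using Qy by linarith
    qed
  qed
  show ?thesis
    using main C(1) unfolding \<alpha>_def by (intro exI[of _ C]) auto
qed

theorem theorem1p1:
  "\<exists>\<alpha> \<in> soft_Omega (\<lambda>\<epsilon>. \<epsilon>). (\<forall>\<epsilon>>0. \<alpha> \<epsilon> > 0) \<and>
     (\<forall>\<epsilon>>0. \<exists>C>0. \<forall>k::nat. real k \<ge> C \<longrightarrow>
        (\<forall>M Q. randomized_algorithm k M \<and> achieves_ratio k M (1 / 2 + \<epsilon>) \<and>
               amortized_query_complexity M Q \<longrightarrow>
           (\<forall>n::nat. real n \<ge> C * real k \<longrightarrow> Q n \<ge> real n powr \<alpha> \<epsilon> / real k ^ 3)))"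
proof (intro bexI[OF _ exponent_soft_Omega] conjI allI impI exponent_pos)
  fix \<epsilon> :: real assume "\<epsilon> > 0"
  then have "0 < min \<epsilon> (1 / 2)" "min \<epsilon> (1 / 2) \<le> 1 / 2"
    by auto
  from query_complexity_bound[OF this] obtain C where C: "C > 0"
    "\<And>k M Q \<gamma> n. real k \<ge> C \<Longrightarrow> 1 / 2 + min \<epsilon> (1 / 2) \<le> \<gamma> \<Longrightarrow> randomized_algorithm k M \<Longrightarrow>
      achieves_ratio k M \<gamma> \<Longrightarrow> amortized_query_complexity M Q \<Longrightarrow> real n \<ge> C * real k \<Longrightarrow>
      real n powr exponent \<epsilon> / real k ^ 3 \<le> Q n"
    unfolding exponent_def by blast
  \<comment> \<open>For \<epsilon> above \<open>1 / 2\<close> the ratio is even larger than the one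
    needed at \<open>1 / 2\<close>, whose parameters are used.\<close>
  have "1 / 2 + min \<epsilon> (1 / 2) \<le> 1 / 2 + \<epsilon>"
    by simp
  with C show "\<exists>C>0. \<forall>k::nat. real k \<ge> C \<longrightarrow>
        (\<forall>M Q. randomized_algorithm k M \<and> achieves_ratio k M (1 / 2 + \<epsilon>) \<and>
               amortized_query_complexity M Q \<longrightarrow>
           (\<forall>n::nat. real n \<ge> C * real k \<longrightarrow> Q n \<ge> real n powr exponent \<epsilon> / real k ^ 3))"
    by blast
qed

end
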